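(* Let $(Y_1,\dots,Y_n)$ be multinomial with parameters $(k,\frac1n,\dots,\frac1n)$ (the box counts when $k$ balls are dropped independently and uniformly into $n$ boxes), and let $Y_{(n)}=\max_{1\le i\le n}Y_i$. Suppose that $\lambda=\frac kn$ is fixed. Let $m_n,p_n$ be the sequences defined in the context, for $F$ the distribution function of a Poisson random variable with parameter $\lambda$. Then, as $n\to\infty$, $$\mathbb P(Y_{(n)}=m_n)\sim p_n,\qquad \mathbb P(Y_{(n)}=m_n+1)\sim1-p_n .$$
   Context: $a_n\sim b_n$ means $a_n/b_n\to1$. Definition of $m_n,p_n$ for a distribution function $F$ of an integer-valued random variable with support unbounded above. Let $\mathcal F=1-F$, and let $\mathcal G$ be a real extension of $\mathcal F$, i.e. a function on $\mathbb R$ with $\mathcal G(j)=\mathcal F(j)$ for all $j\in\mathbb Z$, which is continuous, decreasing and log-concave. For $n\ge2$ let $x_n$ be the (unique) solution of $\mathcal G(x_n)=\frac1n$, and set $$m_n=\left\lfloor x_n+\tfrac12\right\rfloor,\qquad \theta_n=\frac{\mathcal G(m_n)}{\mathcal G(x_n)},\qquad p_n=e^{-\theta_n}.$$ *)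

theory Defs
  imports "HOL-Probability.Probability" "HOL-Library.Landau_Symbols"
begin

definition log_concave_fun :: "(real \<Rightarrow> real) \<Rightarrow> bool" where
  "log_concave_fun G \<longleftrightarrow> (\<forall>x. G x > 0) \<and> concave_on UNIV (\<lambda>x. ln (G x))"

(* "Decreasing" has to be read as non-increasing: if F vanishes on the negative integers
   (as for the Poisson distribution), then G equals 1 at all negative integers. *)
definition tail_extension :: "(real \<Rightarrow> real) \<Rightarrow> (real \<Rightarrow> real) \<Rightarrow> bool" where
  "tail_extension F G \<longleftrightarrow>
     (\<forall>j::int. G (of_int j) = 1 - F (of_int j)) \<and>
     continuous_on UNIV G \<and> antimono G \<and> log_concave_fun G"

(* For a tail extension G of an unbounded integer-valued distribution, the solution is unique
   for n \<ge> 2; the values for n < 2 carry no meaning. *)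
definition x_seq :: "(real \<Rightarrow> real) \<Rightarrow> nat \<Rightarrow> real" where
  "x_seq G n = (THE x. G x = 1 / real n)"

definition m_seq :: "(real \<Rightarrow> real) \<Rightarrow> nat \<Rightarrow> int" where
  "m_seq G n = \<lfloor>x_seq G n + 1 / 2\<rfloor>"

definition theta_seq :: "(real \<Rightarrow> real) \<Rightarrow> nat \<Rightarrow> real" where
  "theta_seq G n = G (of_int (m_seq G n)) / G (x_seq G n)"

definition p_seq :: "(real \<Rightarrow> real) \<Rightarrow> nat \<Rightarrow> real" where
  "p_seq G n = exp (- theta_seq G n)"

definition poisson_cdf :: "real \<Rightarrow> real \<Rightarrow> real" where
  "poisson_cdf rate = cdf (distr (measure_pmf (poisson_pmf rate)) borel real)"

(* The random vector (Y 0, ..., Y (n - 1)) on the probability space M is multinomial with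
   parameters (k, q 0, ..., q (n - 1)).  The mass function is prescribed on the vectors of
   total k; these masses sum to 1, so all other vectors have probability 0. *)
definition multinomial_vector ::
  "'a measure \<Rightarrow> (nat \<Rightarrow> 'a \<Rightarrow> nat) \<Rightarrow> nat \<Rightarrow> nat \<Rightarrow> (nat \<Rightarrow> real) \<Rightarrow> bool" where
  "multinomial_vector M Y n k q \<longleftrightarrow>
     prob_space M \<and>
     (\<forall>i<n. q i \<ge> 0) \<and> (\<Sum>i<n. q i) = 1 \<and>
     (\<forall>i<n. Y i \<in> measurable M (count_space UNIV)) \<and>
     (\<forall>y :: nat \<Rightarrow> nat. (\<Sum>i<n. y i) = k \<longrightarrow>
        measure M {\<omega> \<in> space M. \<forall>i<n. Y i \<omega> = y i} =
          fact k / (\<Prod>i<n. fact (y i)) * (\<Prod>i<n. q i ^ y i))"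

definition max_count :: "(nat \<Rightarrow> 'a \<Rightarrow> nat) \<Rightarrow> nat \<Rightarrow> 'a \<Rightarrow> nat" where
  "max_count Y n \<omega> = Max ((\<lambda>i. Y i \<omega>) ` {..<n})"

end

theory Submission
  imports Defs "HOL-Real_Asymp.Real_Asymp"
begin

text \<open>
  Let \<open>T a m\<close> be the probability that a Poisson variable of mean \<open>a\<close> exceeds \<open>m\<close>. If a Poisson
  number of balls of mean \<open>n a\<close> is dropped, the cell counts are independent, and the maximum is at
  most \<open>m\<close> with probability \<open>(1 - T a m)\<^sup>n\<close>. For a fixed number of balls this probability decreases
  in that number, so taking \<open>a = \<lambda> (1 \<plusminus> d)\<close> with \<open>d = n\<^sup>-\<^sup>1\<^sup>/\<^sup>3\<close> sandwiches it up to Chernoff errors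
  that are exponentially small in \<open>n\<^sup>1\<^sup>/\<^sup>3\<close>.

  Log-concavity of \<open>G\<close> and \<open>T \<lambda> (m + 1) / T \<lambda> m \<asymp> 1 / m\<close> place \<open>\<theta> = n T \<lambda> m\<^sub>n\<close> between constant
  multiples of \<open>m\<^sub>n\<^sup>-\<^sup>1\<^sup>/\<^sup>2\<close> and \<open>m\<^sub>n\<^sup>1\<^sup>/\<^sup>2\<close>, while \<open>m\<^sub>n \<le> ln n\<close>. Hence the maximum is at most \<open>m\<^sub>n\<close> with
  probability \<open>(1 + o(1)) exp (- \<theta>)\<close>, where the error is small even relative to \<open>\<theta>\<close>. The factor
  \<open>m\<^sub>n\<close> gained by moving one integer to the left or right beats \<open>\<theta>\<close> or \<open>1 / \<theta>\<close>, so the maximum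
  is at most \<open>m\<^sub>n - 1\<close>, or more than \<open>m\<^sub>n + 1\<close>, with negligible probability even when \<open>p\<^sub>n\<close> or
  \<open>1 - p\<^sub>n\<close> tends to \<open>0\<close>.
\<close>

subsection \<open>Occupancy probabilities\<close>

definition exp_trunc :: "nat \<Rightarrow> real poly" where
  "exp_trunc m = (\<Sum>j\<le>m. monom (1 / fact j) j)"

text \<open>
  \<open>cells_le_prob n k m\<close> is the probability that none of \<open>n\<close> cells receives more than \<open>m\<close> of
  \<open>k\<close> balls, see \<open>measure_multinomial_all_le\<close> below; it is read off the exponential generating
  function \<open>exp_trunc m ^ n\<close>.
\<close>

definition cells_le_prob :: "nat \<Rightarrow> nat \<Rightarrow> nat \<Rightarrow> real" where
  "cells_le_prob n k m = fact k / real n ^ k * coeff (exp_trunc m ^ n) k"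

text \<open>The \<open>T a m\<close> of the overview. As an explicit formula in a real
  \<open>a\<close> it can be differentiated in the mean.\<close>

definition poisson_tail :: "real \<Rightarrow> nat \<Rightarrow> real" where
  "poisson_tail a m = 1 - exp (- a) * (\<Sum>j\<le>m. a ^ j / fact j)"

lemma poly_exp_trunc: "poly (exp_trunc m) a = (\<Sum>j\<le>m. a ^ j / fact j)"
  by (simp add: exp_trunc_def poly_sum poly_monom)

lemma pderiv_exp_trunc: "pderiv (exp_trunc m) = exp_trunc m - monom (1 / fact m) m"
proof (induction m)
  case 0
  then show ?case by (simp add: exp_trunc_def pderiv_monom)
next
  case (Suc m)
  have "fact m + real m * fact m = (1 + real m) * fact m" and "1 + real m \<noteq> 0"
    by (simp add: algebra_simps) linarith
  then have "(1 + real m) / (fact m + real m * fact m) = 1 / fact m"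
    by simp
  with Suc show ?case by (simp add: exp_trunc_def pderiv_add pderiv_monom)
qed

text \<open>Expanding the product picks one exponent per cell, so degree \<open>k\<close> collects
  the count vectors of total \<open>k\<close> with entries at most \<open>m\<close>. Scaled by
  \<open>fact k / n ^ k\<close>, their contributions are multinomial masses.\<close>

lemma coeff_exp_trunc_power:
  "coeff (exp_trunc m ^ n) k
     = (\<Sum>f \<in> {f \<in> {..<n} \<rightarrow>\<^sub>E {..m}. (\<Sum>i<n. f i) = k}. \<Prod>i<n. 1 / fact (f i))"
proof -
  have mon: "(\<Prod>i\<in>A. monom (c i) (f i)) = monom (\<Prod>i\<in>A. c i) (\<Sum>i\<in>A. f i)"
    if "finite A" for A :: "nat set" and c :: "nat \<Rightarrow> real" and f
    using that by (induction A rule: finite_induct) (simp_all add: mult_monom)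
  have "exp_trunc m ^ n = (\<Prod>i<n. \<Sum>j\<le>m. monom (1 / fact j) j)"
    by (simp add: exp_trunc_def)
  also have "\<dots> = (\<Sum>f \<in> {..<n} \<rightarrow>\<^sub>E {..m}. \<Prod>i<n. monom (1 / fact (f i)) (f i))"
    by (rule prod_sum_PiE) auto
  also have "\<dots> = (\<Sum>f \<in> {..<n} \<rightarrow>\<^sub>E {..m}. monom (\<Prod>i<n. 1 / fact (f i)) (\<Sum>i<n. f i))"
    by (simp add: mon)
  finally have "coeff (exp_trunc m ^ n) k
     = (\<Sum>f \<in> {..<n} \<rightarrow>\<^sub>E {..m}. if (\<Sum>i<n. f i) = k then \<Prod>i<n. 1 / fact (f i) else 0)"
    by (simp add: coeff_sum)
  also have "\<dots> = (\<Sum>f \<in> {f \<in> {..<n} \<rightarrow>\<^sub>E {..m}. (\<Sum>i<n. f i) = k}. \<Prod>i<n. 1 / fact (f i))"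
    by (rule sum.inter_filter[symmetric]) (auto intro: finite_PiE)
  finally show ?thesis .
qed

lemma coeff_exp_trunc_power_nonneg: "0 \<le> coeff (exp_trunc m ^ n) k"
  unfolding coeff_exp_trunc_power by (intro sum_nonneg prod_nonneg) auto

text \<open>
  Compares coefficients in \<open>(E\<^sup>n)' = n E\<^sup>n\<^sup>-\<^sup>1 E'\<close> with \<open>E' = E - x\<^sup>m / m!\<close>. The sign of the
  correction term makes \<open>cells_le_prob\<close> decreasing in the number of balls.
\<close>

lemma coeff_exp_trunc_power_Suc:
  assumes "n > 0"
  shows "real (Suc k) * coeff (exp_trunc m ^ n) (Suc k) = real n * (coeff (exp_trunc m ^ n) k
    - (if k < m then 0 else coeff (exp_trunc m ^ (n - 1)) (k - m) / fact m))"
proof -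
  obtain n' where n: "n = Suc n'" using assms by (cases n) auto
  have "pderiv (exp_trunc m ^ n) = smult (real n) (exp_trunc m ^ n' * (exp_trunc m - monom (1 / fact m) m))"
    by (simp only: n pderiv_power_Suc pderiv_exp_trunc) simp
  also have "\<dots> = smult (real n) (exp_trunc m ^ n - monom (1 / fact m) m * exp_trunc m ^ n')"
    by (simp add: n algebra_simps)
  finally have "coeff (pderiv (exp_trunc m ^ n)) k
     = coeff (smult (real n) (exp_trunc m ^ n - monom (1 / fact m) m * exp_trunc m ^ n')) k"
    by simp
  then show ?thesis
    by (simp only: coeff_pderiv coeff_smult coeff_diff coeff_monom_mult) (simp add: n)
qed

lemma cells_le_prob_nonneg: "0 \<le> cells_le_prob n k m"
  by (simp add: cells_le_prob_def coeff_exp_trunc_power_nonneg)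

text \<open>With a common factor taken out, this is the coefficient recurrence, whose correction
  term is nonnegative. For \<open>k < m\<close> the correction is absent:
  \<open>k + 1 \<le> m\<close> balls cannot overfill a cell.\<close>

lemma cells_le_prob_Suc:
  assumes "n > 0"
  shows "cells_le_prob n (Suc k) m \<le> cells_le_prob n k m"
    and "k < m \<Longrightarrow> cells_le_prob n (Suc k) m = cells_le_prob n k m"
proof -
  let ?c = "coeff (exp_trunc m ^ n)"
  have eq: "cells_le_prob n (Suc k) m = fact k / real n ^ Suc k * (real (Suc k) * ?c (Suc k))"
    by (simp add: cells_le_prob_def)
  have eq': "cells_le_prob n k m = fact k / real n ^ Suc k * (real n * ?c k)"
    using assms by (simp add: cells_le_prob_def)
  have "real (Suc k) * ?c (Suc k) \<le> real n * ?c k"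
    using coeff_exp_trunc_power_nonneg[of m "n - 1" "k - m"]
    by (subst coeff_exp_trunc_power_Suc[OF assms], intro mult_left_mono) auto
  then show "cells_le_prob n (Suc k) m \<le> cells_le_prob n k m"
    unfolding eq eq' by (rule mult_left_mono) simp
  show "cells_le_prob n (Suc k) m = cells_le_prob n k m" if "k < m"
    unfolding eq eq' coeff_exp_trunc_power_Suc[OF assms] using that by simp
qed

lemma antimono_cells_le_prob: "n > 0 \<Longrightarrow> antimono (\<lambda>k. cells_le_prob n k m)"
  by (rule decseq_SucI) (rule cells_le_prob_Suc)

lemma cells_le_prob_eq_1:
  assumes "n > 0" "k \<le> m"
  shows "cells_le_prob n k m = 1"
  using assms(2)
proof (induction k)
  case 0
  have "coeff (exp_trunc m) 0 = 1"
    by (simp add: exp_trunc_def coeff_sum sum.delta)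
  then show ?case by (simp add: cells_le_prob_def coeff_0_power)
next
  case (Suc k)
  then show ?case using cells_le_prob_Suc(2)[OF assms(1), of k m] by simp
qed

lemma cells_le_prob_le_1:
  assumes "n > 0"
  shows "cells_le_prob n k m \<le> 1"
  using antimonoD[OF antimono_cells_le_prob[OF assms], of 0 k m]
    cells_le_prob_eq_1[OF assms, of 0 m] by simp

text \<open>Given their total, independent Poisson counts of mean \<open>a\<close> are multinomial
  with equal cell probabilities. The sum is finite because coefficients beyond the degree vanish;
  \<open>D\<close> is kept free so that it can be taken at least as large as a cut-off
  \<open>K\<close>.\<close>

lemma poissonization:
  assumes "n > 0" and "degree (exp_trunc m ^ n) \<le> D"
  shows "(\<Sum>k\<le>D. exp (- (real n * a)) * (real n * a) ^ k / fact k * cells_le_prob n k m)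
    = (1 - poisson_tail a m) ^ n"
proof -
  have "poly (exp_trunc m ^ n) a = (\<Sum>k\<le>D. coeff (exp_trunc m ^ n) k * a ^ k)"
    unfolding poly_altdef
    by (rule sum.mono_neutral_left) (use assms in \<open>auto simp: coeff_eq_0\<close>)
  moreover have "(1 - poisson_tail a m) ^ n = exp (- (real n * a)) * poly (exp_trunc m ^ n) a"
    by (simp add: poisson_tail_def poly_exp_trunc power_mult_distrib flip: exp_of_nat_mult)
  ultimately show ?thesis
    using assms(1) by (simp add: sum_distrib_left cells_le_prob_def power_mult_distrib field_simps)
qed

section \<open>Multinomial vectors and their maximum\<close>

lemma sets_multinomial_vector:
  assumes "multinomial_vector M Y n k q"
  shows "{\<omega> \<in> space M. \<forall>i<n. P i (Y i \<omega>)} \<in> sets M"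
proof -
  have "n \<noteq> 0" using assms by (cases n) (auto simp: multinomial_vector_def)
  have "{\<omega> \<in> space M. \<forall>i\<in>{..<n}. P i (Y i \<omega>)} \<in> sets M"
  proof (rule sets.sets_Collect_finite_All')
    fix i assume "i \<in> {..<n}"
    then have "Y i \<in> measurable M (count_space UNIV)"
      using assms by (simp add: multinomial_vector_def)
    from measurable_sets[OF this, of "Collect (P i)"]
    show "{\<omega> \<in> space M. P i (Y i \<omega>)} \<in> sets M"
      by (simp add: vimage_def Int_def conj_commute)
  qed (use \<open>n \<noteq> 0\<close> in auto)
  then show ?thesis by (simp only: Ball_def lessThan_iff)
qed

text \<open>\<open>multinomial_vector\<close> prescribes masses only for vectors of total
  \<open>k\<close>. The probability is therefore computed inside the event \<open>C\<close> that the
  total is \<open>k\<close>, and \<open>C\<close> is then shown to have probability 1.\<close>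

lemma measure_multinomial_all_le:
  assumes "multinomial_vector M Y n k (\<lambda>i. 1 / real n)"
  shows "measure M {\<omega> \<in> space M. \<forall>i<n. Y i \<omega> \<le> m} = cells_le_prob n k m"
proof -
  interpret prob_space M using assms by (simp add: multinomial_vector_def)
  have n: "n > 0"
    using assms by (cases n) (auto simp: multinomial_vector_def)
  define S where "S m = {f \<in> {..<n} \<rightarrow>\<^sub>E {..m}. (\<Sum>i<n. f i) = k}" for m
  define A where "A f = {\<omega> \<in> space M. \<forall>i<n. Y i \<omega> = f i}" for f
  define B where "B m = {\<omega> \<in> space M. \<forall>i<n. Y i \<omega> \<le> m}" for m
  define C where "C = {\<omega> \<in> space M. (\<Sum>i<n. Y i \<omega>) = k}"
  have fin: "finite (S m)" for m
    by (simp add: S_def finite_PiE)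
  have A: "A f \<in> sets M" for f
    unfolding A_def by (rule sets_multinomial_vector[OF assms])
  have B: "B m \<in> sets M" for m
    unfolding B_def by (rule sets_multinomial_vector[OF assms])
  have "measure M (A f) = fact k / real n ^ k * (\<Prod>i<n. 1 / fact (f i))" if "f \<in> S m" for f m
  proof -
    have sum: "(\<Sum>i<n. f i) = k" using that by (simp add: S_def)
    then have "measure M (A f) = fact k / (\<Prod>i<n. fact (f i)) * (\<Prod>i<n. (1 / real n) ^ f i)"
      using assms by (simp add: multinomial_vector_def A_def)
    also have "(\<Prod>i<n. (1 / real n) ^ f i) = (1 / real n) ^ k"
      by (simp add: sum flip: power_sum)
    finally show ?thesis by (simp add: prod_dividef power_one_over mult.commute)
  qed
  moreover have "disjoint_family_on A (S m)" for m
    unfolding disjoint_family_on_def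
  proof (intro ballI impI)
    fix f g assume fg: "f \<in> S m" "g \<in> S m" "f \<noteq> g"
    then obtain i where "i < n" "f i \<noteq> g i"
      unfolding S_def by (metis (no_types, lifting) PiE_ext lessThan_iff mem_Collect_eq)
    then show "A f \<inter> A g = {}" by (auto simp: A_def)
  qed
  ultimately have "measure M (\<Union>f\<in>S m. A f) = (\<Sum>f\<in>S m. fact k / real n ^ k * (\<Prod>i<n. 1 / fact (f i)))" for m
    by (subst finite_measure_finite_Union) (use A fin in auto)
  then have cells: "measure M (\<Union>f\<in>S m. A f) = cells_le_prob n k m" for m
    by (simp add: cells_le_prob_def coeff_exp_trunc_power S_def sum_distrib_left)
  have U: "(\<Union>f\<in>S m. A f) = B m \<inter> C" for m
  proof (intro equalityI subsetI)
    fix \<omega> assume "\<omega> \<in> (\<Union>f\<in>S m. A f)"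
    then obtain f where f: "f \<in> S m" "\<omega> \<in> A f" by blast
    then have "(\<Sum>i<n. Y i \<omega>) = (\<Sum>i<n. f i)"
      by (intro sum.cong) (auto simp: A_def)
    with f show "\<omega> \<in> B m \<inter> C" by (auto simp: A_def B_def C_def S_def PiE_iff)
  next
    fix \<omega> assume w: "\<omega> \<in> B m \<inter> C"
    \<comment> \<open>Elements of \<open>S m\<close> are extensional, so the count vector has to be
      cut off outside \<open>{..<n}\<close>.\<close>
    then have "restrict (\<lambda>i. Y i \<omega>) {..<n} \<in> S m"
      by (auto simp: S_def B_def C_def)
    moreover have "\<omega> \<in> A (restrict (\<lambda>i. Y i \<omega>) {..<n})"
      using w by (auto simp: A_def B_def)
    ultimately show "\<omega> \<in> (\<Union>f\<in>S m. A f)" by blast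
  qed
  \<comment> \<open>No cell holds more than the total, so \<open>C\<close> is the case
    \<open>m = k\<close>, in which \<open>cells_le_prob\<close> is 1.\<close>
  have "C \<subseteq> B k"
    by (auto simp: B_def C_def intro!: member_le_sum)
  then have C: "C = (\<Union>f\<in>S k. A f)" by (auto simp: U)
  then have C_sets: "C \<in> sets M" using A fin by auto
  have "prob C = 1"
    using cells[of k] n by (simp add: C cells_le_prob_eq_1)
  then have "AE \<omega> in M. \<omega> \<in> C"
    by (rule AE_prob_1)
  then have "measure M (B m) = measure M (B m \<inter> C)"
    using B C_sets by (intro finite_measure_eq_AE) auto
  with cells U show ?thesis by (simp add: B_def)
qed

lemma measure_max_count_eq_Suc:
  assumes "multinomial_vector M Y n k (\<lambda>i. 1 / real n)"
  shows "measure M {\<omega> \<in> space M. max_count Y n \<omega> = Suc m} = cells_le_prob n k (Suc m) - cells_le_prob n k m"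
proof -
  interpret prob_space M using assms by (simp add: multinomial_vector_def)
  have "n \<noteq> 0" using assms by (cases n) (auto simp: multinomial_vector_def)
  then have "max_count Y n \<omega> \<le> m \<longleftrightarrow> (\<forall>i<n. Y i \<omega> \<le> m)" for \<omega> m
    unfolding max_count_def by (subst Max_le_iff) auto
  then have "max_count Y n \<omega> = Suc m \<longleftrightarrow> (\<forall>i<n. Y i \<omega> \<le> Suc m) \<and> \<not> (\<forall>i<n. Y i \<omega> \<le> m)" for \<omega>
    by (metis le_Suc_eq le_refl not_less_eq_eq)
  then have "{\<omega> \<in> space M. max_count Y n \<omega> = Suc m}
      = {\<omega> \<in> space M. \<forall>i<n. Y i \<omega> \<le> Suc m} - {\<omega> \<in> space M. \<forall>i<n. Y i \<omega> \<le> m}"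
    by blast
  moreover have "measure M ({\<omega> \<in> space M. \<forall>i<n. Y i \<omega> \<le> Suc m} - {\<omega> \<in> space M. \<forall>i<n. Y i \<omega> \<le> m})
      = cells_le_prob n k (Suc m) - cells_le_prob n k m"
    unfolding measure_multinomial_all_le[OF assms, symmetric]
    by (intro finite_measure_Diff sets_multinomial_vector[OF assms]) auto
  ultimately show ?thesis by simp
qed

subsection \<open>Poisson tails\<close>

text \<open>Differentiating the truncated series loses only its top term, so everything but the
  Poisson weight at \<open>m\<close> cancels. The tail bounds below compare derivatives in the
  mean.\<close>

lemma DERIV_poisson_tail:
  "((\<lambda>a. poisson_tail a m) has_real_derivative exp (- a) * a ^ m / fact m) (at a)"
proof -
  have "((\<lambda>a. 1 - exp (- a) * poly (exp_trunc m) a) has_real_derivative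
      0 - (exp (- a) * poly (pderiv (exp_trunc m)) a + (exp (- a) * (- 1)) * poly (exp_trunc m) a)) (at a)"
    by (auto intro!: derivative_eq_intros poly_DERIV)
  then show ?thesis
    by (simp add: poisson_tail_def poly_exp_trunc pderiv_exp_trunc poly_monom algebra_simps)
qed

lemma poisson_tail_0 [simp]: "poisson_tail 0 m = 0"
proof -
  have "(\<Sum>j\<le>m. (0::real) ^ j / fact j) = 1"
    by (simp add: power_0_left if_distrib[of "\<lambda>x. x / _"] sum.delta cong: if_cong)
  then show ?thesis by (simp add: poisson_tail_def)
qed

lemma poisson_tail_mono:
  assumes "0 \<le> a" "a \<le> b"
  shows "poisson_tail a m \<le> poisson_tail b m"
  by (rule DERIV_nonneg_imp_nondecreasing[OF assms(2)])
    (use assms DERIV_poisson_tail in \<open>force intro!: exI\<close>)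

lemma poisson_tail_nonneg: "0 \<le> a \<Longrightarrow> 0 \<le> poisson_tail a m"
  using poisson_tail_mono[of 0 a m] by simp

lemma poisson_tail_le_1: "0 \<le> a \<Longrightarrow> poisson_tail a m \<le> 1"
  by (simp add: poisson_tail_def sum_nonneg)

lemma DERIV_power_Suc_fact:
  "((\<lambda>a. a ^ Suc m / fact (Suc m)) has_real_derivative x ^ m / fact m) (at x)"
  using DERIV_cdivide[OF DERIV_pow[of "Suc m" x], of "fact (Suc m)"]
  by (simp add: fact_Suc del: of_nat_Suc power_Suc)

text \<open>Both sides vanish at mean 0, and \<open>exp (- x) \<le> 1\<close> compares the
  derivatives. The lower bound after it uses \<open>exp (- a) \<le> exp (- x)\<close> instead, so
  the two bounds differ by a factor \<open>exp a\<close>.\<close>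

lemma poisson_tail_upper:
  assumes "0 \<le> a"
  shows "poisson_tail a m \<le> a ^ Suc m / fact (Suc m)"
proof -
  have d: "((\<lambda>a. a ^ Suc m / fact (Suc m) - poisson_tail a m) has_real_derivative
      x ^ m / fact m - exp (- x) * x ^ m / fact m) (at x)" for x
    by (intro DERIV_diff DERIV_poisson_tail DERIV_power_Suc_fact)
  have "(\<lambda>a. a ^ Suc m / fact (Suc m) - poisson_tail a m) 0
    \<le> (\<lambda>a. a ^ Suc m / fact (Suc m) - poisson_tail a m) a"
  proof (rule DERIV_nonneg_imp_nondecreasing[OF assms])
    fix x :: real assume "0 \<le> x"
    then have "exp (- x) * x ^ m / fact m \<le> x ^ m / fact m"
      by (intro divide_right_mono mult_left_le_one_le) auto
    with d show "\<exists>y. ((\<lambda>a. a ^ Suc m / fact (Suc m) - poisson_tail a m) has_real_derivative y) (at x)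
      \<and> 0 \<le> y" by (force intro!: exI)
  qed
  then show ?thesis by simp
qed

lemma poisson_tail_lower:
  assumes "0 \<le> a"
  shows "exp (- a) * a ^ Suc m / fact (Suc m) \<le> poisson_tail a m"
proof -
  let ?f = "\<lambda>x. poisson_tail x m - exp (- a) * (x ^ Suc m / fact (Suc m))"
  have d: "(?f has_real_derivative
      exp (- x) * x ^ m / fact m - exp (- a) * (x ^ m / fact m)) (at x)" for x
    by (intro DERIV_diff DERIV_poisson_tail DERIV_cmult DERIV_power_Suc_fact)
  have "?f 0 \<le> ?f a"
  proof (rule DERIV_nonneg_imp_nondecreasing[OF assms])
    fix x :: real assume "0 \<le> x" "x \<le> a"
    then have "exp (- a) * (x ^ m / fact m) \<le> exp (- x) * (x ^ m / fact m)"
      by (intro mult_right_mono) auto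
    with d show "\<exists>y. (?f has_real_derivative y) (at x) \<and> 0 \<le> y" by (force intro!: exI)
  qed
  then show ?thesis by simp
qed

lemma poisson_tail_pos: "0 < a \<Longrightarrow> 0 < poisson_tail a m"
  by (rule less_le_trans[OF _ poisson_tail_lower]) auto

lemma power_over_fact_tendsto_0: "(\<lambda>m. x ^ m / fact m) \<longlonglongrightarrow> (0 :: real)"
  using summable_LIMSEQ_zero[OF summable_exp[of x]] by (simp add: field_simps)

lemma poisson_tail_tendsto_0:
  assumes "0 \<le> a"
  shows "(\<lambda>m. poisson_tail a m) \<longlonglongrightarrow> 0"
proof (rule tendsto_sandwich[OF _ _ tendsto_const])
  show "(\<lambda>m. a ^ Suc m / fact (Suc m)) \<longlonglongrightarrow> 0"
    by (rule LIMSEQ_Suc[OF power_over_fact_tendsto_0])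
  show "\<forall>\<^sub>F m in sequentially. poisson_tail a m \<le> a ^ Suc m / fact (Suc m)"
    using poisson_tail_upper[OF assms] by simp
qed (use poisson_tail_nonneg[OF assms] in simp)

text \<open>A bound on the relative change of the tail at \<open>x\<close> when the mean moves from
  \<open>l\<close> to \<open>l * (1 + d)\<close> or \<open>l * (1 - d)\<close>. A real
  \<open>x\<close> allows evaluation at \<open>ln n + 1\<close>.\<close>

definition perturb_err :: "real \<Rightarrow> real \<Rightarrow> real \<Rightarrow> real" where
  "perturb_err l d x = d * exp l * (x + 1) * exp (d * x)"

lemma perturb_err_nonneg: "0 \<le> d \<Longrightarrow> 0 \<le> x \<Longrightarrow> 0 \<le> perturb_err l d x"
  by (simp add: perturb_err_def)

lemma perturb_err_mono: "0 \<le> d \<Longrightarrow> 0 \<le> x \<Longrightarrow> x \<le> y \<Longrightarrow> perturb_err l d x \<le> perturb_err l d y"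
  unfolding perturb_err_def by (intro mult_mono) (auto intro: mult_left_mono)

lemma poisson_tail_diff_le:
  assumes "0 \<le> a" "a \<le> b"
  shows "poisson_tail b m - poisson_tail a m \<le> (b - a) * (b ^ m / fact m)"
proof -
  let ?f = "\<lambda>x. (b ^ m / fact m) * x - poisson_tail x m"
  have "?f a \<le> ?f b"
  proof (rule DERIV_nonneg_imp_nondecreasing[OF assms(2)])
    fix x assume "a \<le> x" "x \<le> b"
    then have "exp (- x) * x ^ m \<le> 1 * b ^ m"
      using assms by (intro mult_mono power_mono) auto
    then have "exp (- x) * x ^ m / fact m \<le> b ^ m / fact m"
      by (simp add: divide_right_mono)
    moreover have "(?f has_real_derivative b ^ m / fact m - exp (- x) * x ^ m / fact m) (at x)"
      by (intro DERIV_diff DERIV_poisson_tail DERIV_cmult_Id)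
    ultimately show "\<exists>y. (?f has_real_derivative y) (at x) \<and> 0 \<le> y"
      by (intro exI[of _ "b ^ m / fact m - exp (- x) * x ^ m / fact m"]) simp
  qed
  then show ?thesis by (simp add: algebra_simps diff_divide_distrib)
qed

text \<open>The left side is \<open>m + 1\<close> times \<open>l ^ Suc m / fact (Suc m)\<close>, the
  leading term of the tail. This turns absolute increments of the tail into relative ones.\<close>

lemma poisson_weight_le_tail:
  assumes "0 < l"
  shows "l * (l ^ m / fact m) \<le> (real m + 1) * exp l * poisson_tail l m"
proof -
  have "l * (l ^ m / fact m) = (real m + 1) * exp l * (exp (- l) * l ^ Suc m / fact (Suc m))"
    by (simp add: exp_minus divide_simps)
  also have "\<dots> \<le> (real m + 1) * exp l * poisson_tail l m"
    using poisson_tail_lower[of l m] assms by (intro mult_left_mono) auto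
  finally show ?thesis .
qed

text \<open>The increment is at most the change of the mean times \<open>b ^ m / fact m\<close> at
  the larger mean \<open>b\<close>. For \<open>b = l * (1 + d)\<close>, the bound
  \<open>(1 + d) ^ m \<le> exp (d * m)\<close> leads back to mean \<open>l\<close>.\<close>

lemma poisson_tail_perturb:
  assumes "0 < l" "0 \<le> d" "d < 1"
  shows "poisson_tail (l * (1 + d)) m \<le> poisson_tail l m * (1 + perturb_err l d m)"
    and "poisson_tail l m * (1 - perturb_err l d m) \<le> poisson_tail (l * (1 - d)) m"
proof -
  have e: "1 \<le> exp (d * real m)" using assms by simp
  have "poisson_tail (l * (1 + d)) m - poisson_tail l m
      \<le> (l * (1 + d) - l) * ((l * (1 + d)) ^ m / fact m)"
    by (rule poisson_tail_diff_le) (use assms in auto)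
  also have "\<dots> = d * (1 + d) ^ m * (l * (l ^ m / fact m))"
    unfolding power_mult_distrib by (simp add: algebra_simps)
  also have "\<dots> \<le> d * exp (d * real m) * (l * (l ^ m / fact m))"
    using assms power_mono[of "1 + d" "exp d" m]
    by (intro mult_right_mono mult_left_mono) (simp_all add: mult.commute flip: exp_of_nat_mult)
  also have "d * exp (d * real m) * (l * (l ^ m / fact m))
      \<le> d * exp (d * real m) * ((real m + 1) * exp l * poisson_tail l m)"
    using assms poisson_weight_le_tail by (intro mult_left_mono) auto
  finally show "poisson_tail (l * (1 + d)) m \<le> poisson_tail l m * (1 + perturb_err l d m)"
    by (simp add: perturb_err_def algebra_simps)
  have "poisson_tail l m - poisson_tail (l * (1 - d)) m \<le> d * (l * (l ^ m / fact m))"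
    using poisson_tail_diff_le[of "l * (1 - d)" l m] assms
    by (simp add: algebra_simps)
  \<comment> \<open>Inserting the factor \<open>exp (d * m) \<ge> 1\<close> gives both directions
    the same error term.\<close>
  also have "\<dots> \<le> d * exp (d * real m) * (l * (l ^ m / fact m))"
    using assms e mult_left_mono[OF e, of d] by (intro mult_right_mono) auto
  also have "\<dots> \<le> d * exp (d * real m) * ((real m + 1) * exp l * poisson_tail l m)"
    using assms poisson_weight_le_tail by (intro mult_left_mono) auto
  finally show "poisson_tail l m * (1 - perturb_err l d m) \<le> poisson_tail (l * (1 - d)) m"
    by (simp add: perturb_err_def algebra_simps)
qed

text \<open>Each tail lies between \<open>exp (- l)\<close> times its leading term and that term,
  and the leading terms at \<open>m + 1\<close> and \<open>m\<close> have quotient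
  \<open>l / (m + 2)\<close>.\<close>

lemma poisson_tail_ratio:
  assumes "0 < l"
  shows "exp (- l) * l / (real m + 2) * poisson_tail l m \<le> poisson_tail l (Suc m)"
    and "poisson_tail l (Suc m) \<le> exp l * l / (real m + 2) * poisson_tail l m"
proof -
  have eq: "l ^ Suc (Suc m) / fact (Suc (Suc m)) = l / (real m + 2) * (l ^ Suc m / fact (Suc m))"
    by (simp only: power_Suc fact_Suc of_nat_mult times_divide_times_eq) (simp add: add.commute)
  have "exp (- l) * l / (real m + 2) * poisson_tail l m
      \<le> exp (- l) * l / (real m + 2) * (l ^ Suc m / fact (Suc m))"
    using poisson_tail_upper[of l m] assms by (intro mult_left_mono) auto
  also have "\<dots> = exp (- l) * (l ^ Suc (Suc m) / fact (Suc (Suc m)))"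
    unfolding eq by simp
  also have "\<dots> \<le> poisson_tail l (Suc m)"
    using poisson_tail_lower[of l "Suc m"] assms by simp
  finally show "exp (- l) * l / (real m + 2) * poisson_tail l m \<le> poisson_tail l (Suc m)" .
  have "poisson_tail l (Suc m) \<le> l ^ Suc (Suc m) / fact (Suc (Suc m))"
    using poisson_tail_upper[of l "Suc m"] assms by simp
  also have "\<dots> = exp l * l / (real m + 2) * (exp (- l) * l ^ Suc m / fact (Suc m))"
    unfolding eq by (simp add: exp_minus)
  also have "\<dots> \<le> exp l * l / (real m + 2) * poisson_tail l m"
    using poisson_tail_lower[of l m] assms by (intro mult_left_mono) auto
  finally show "poisson_tail l (Suc m) \<le> exp l * l / (real m + 2) * poisson_tail l m" .
qed

subsection \<open>Sandwiching by Poissonization\<close>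

text \<open>Exponential Markov inequality: each term with \<open>j \<le> K\<close> is enlarged by
  the factor \<open>s ^ j / s ^ K \<ge> 1\<close>. For \<open>s \<ge> 1\<close> the same factor
  serves the terms with \<open>j > K\<close> in the upper tail.\<close>

lemma poisson_lower_tail_chernoff:
  assumes "0 \<le> a" "0 < s" "s \<le> 1"
  shows "1 - poisson_tail a K \<le> exp (a * s - a) / s ^ K"
proof -
  have "(\<Sum>j\<le>K. a ^ j / fact j) \<le> (\<Sum>j\<le>K. (a * s) ^ j / fact j / s ^ K)"
  proof (rule sum_mono)
    fix j assume "j \<in> {..K}"
    then have "s ^ K \<le> s ^ j" using assms by (intro power_decreasing) auto
    then have "1 \<le> s ^ j / s ^ K" using assms by simp
    then have "a ^ j / fact j * 1 \<le> a ^ j / fact j * (s ^ j / s ^ K)"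
      using assms by (intro mult_left_mono) auto
    then show "a ^ j / fact j \<le> (a * s) ^ j / fact j / s ^ K"
      by (simp add: power_mult_distrib)
  qed
  also have "\<dots> = (\<Sum>j\<le>K. (a * s) ^ j / fact j) / s ^ K"
    by (simp add: sum_divide_distrib)
  \<comment> \<open>The partial sum is at most the full exponential because the tail of mean
    \<open>a * s\<close> is nonnegative.\<close>
  also have "\<dots> \<le> exp (a * s) / s ^ K"
    using poisson_tail_nonneg[of "a * s" K] assms
    by (intro divide_right_mono) (auto simp: poisson_tail_def exp_minus field_simps)
  finally have "exp (- a) * (\<Sum>j\<le>K. a ^ j / fact j) \<le> exp (- a) * (exp (a * s) / s ^ K)"
    by (rule mult_left_mono) simp
  then show ?thesis by (simp add: poisson_tail_def exp_diff exp_minus field_simps)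
qed

lemma poisson_upper_tail_chernoff:
  assumes "0 \<le> a" "1 \<le> s"
  shows "poisson_tail a K \<le> exp (a * s - a) / s ^ K"
proof -
  have sums: "(\<lambda>j. x ^ j / fact j) sums exp x" for x :: real
    using exp_converges[of x] by (simp add: field_simps)
  have le: "(if j \<le> K then 0 else a ^ j / fact j) \<le> (a * s) ^ j / fact j / s ^ K" for j
  proof (cases "j \<le> K")
    case False
    then have "s ^ K \<le> s ^ j" using assms by (intro power_increasing) auto
    then have "1 \<le> s ^ j / s ^ K" using assms by simp
    then have "a ^ j / fact j * 1 \<le> a ^ j / fact j * (s ^ j / s ^ K)"
      using assms by (intro mult_left_mono) auto
    with False show ?thesis by (simp add: power_mult_distrib)
  qed (use assms in auto)
  have "(\<lambda>j. a ^ j / fact j - (if j \<in> {..K} then a ^ j / fact j else 0)) sums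
      (exp a - (\<Sum>j\<le>K. a ^ j / fact j))"
    by (intro sums_diff sums sums_If_finite_set) auto
  also have "(\<lambda>j. a ^ j / fact j - (if j \<in> {..K} then a ^ j / fact j else 0))
      = (\<lambda>j. if j \<le> K then 0 else a ^ j / fact j)"
    by auto
  finally have "exp a - (\<Sum>j\<le>K. a ^ j / fact j) \<le> exp (a * s) / s ^ K"
    by (rule sums_le[OF le _ sums_divide[OF sums]])
  then have "exp (- a) * (exp a - (\<Sum>j\<le>K. a ^ j / fact j)) \<le> exp (- a) * (exp (a * s) / s ^ K)"
    by (rule mult_left_mono) simp
  then show ?thesis
    by (simp add: poisson_tail_def exp_diff exp_minus field_simps)
qed

text \<open>The Poissonized probability is a mixture of the \<open>?q k\<close>, cut at
  \<open>k = K\<close>. Since \<open>?q\<close> decreases, the terms above \<open>K\<close> add at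
  most \<open>?q K\<close>; those up to \<open>K\<close> add at most their total weight, and at
  least \<open>?q K\<close> times it.\<close>

lemma poissonization_bounds:
  assumes "n > 0" "a \<ge> 0"
  shows "(1 - poisson_tail a m) ^ n - (1 - poisson_tail (real n * a) K) \<le> cells_le_prob n K m"
    and "cells_le_prob n K m * (1 - poisson_tail (real n * a) K) \<le> (1 - poisson_tail a m) ^ n"
proof -
  let ?L = "(1 - poisson_tail a m) ^ n" and ?R = "1 - poisson_tail (real n * a) K"
    and ?q = "\<lambda>k. cells_le_prob n k m"
  define p where "p k = exp (- (real n * a)) * (real n * a) ^ k / fact k" for k
  define D where "D = max K (degree (exp_trunc m ^ n))"
  have p0: "p k \<ge> 0" for k using assms by (simp add: p_def)
  have q: "0 \<le> ?q k" "?q k \<le> 1" for k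
    using cells_le_prob_nonneg cells_le_prob_le_1 assms by auto
  have pK: "(\<Sum>k\<le>K. p k) = 1 - poisson_tail (real n * a) K" for K
    by (simp add: p_def poisson_tail_def sum_distrib_left)
  have pD: "(\<Sum>k\<in>{K<..D}. p k) \<le> 1"
  proof -
    have "(\<Sum>k\<in>{K<..D}. p k) \<le> (\<Sum>k\<le>D. p k)"
      by (rule sum_mono2) (use p0 in auto)
    then show ?thesis using pK[of D] poisson_tail_nonneg[of "real n * a" D] assms by simp
  qed
  have eq: "?L = (\<Sum>k\<le>D. p k * ?q k)"
    unfolding p_def by (rule poissonization[symmetric]) (use assms in \<open>auto simp: D_def\<close>)
  have "{..D} = {..K} \<union> {K<..D}" by (auto simp: D_def)
  then have split: "?L = (\<Sum>k\<le>K. p k * ?q k) + (\<Sum>k\<in>{K<..D}. p k * ?q k)"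
    unfolding eq by (simp only:) (rule sum.union_disjoint, auto)
  have "?q K * (\<Sum>k\<le>K. p k) \<le> (\<Sum>k\<le>K. p k * ?q k)"
    unfolding sum_distrib_left mult.commute[of "?q K"]
    using antimonoD[OF antimono_cells_le_prob] p0 assms
    by (intro sum_mono mult_left_mono) auto
  moreover have "0 \<le> (\<Sum>k\<in>{K<..D}. p k * ?q k)"
    using p0 q by (intro sum_nonneg) auto
  ultimately show "?q K * (1 - poisson_tail (real n * a) K) \<le> ?L"
    using pK[of K] split by simp
  have "(\<Sum>k\<le>K. p k * ?q k) \<le> (\<Sum>k\<le>K. p k)"
    using p0 q by (intro sum_mono) (simp add: mult_left_le)
  moreover have "(\<Sum>k\<in>{K<..D}. p k * ?q k) \<le> ?q K * (\<Sum>k\<in>{K<..D}. p k)"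
    unfolding sum_distrib_left mult.commute[of "?q K"]
    using antimonoD[OF antimono_cells_le_prob] p0 assms
    by (intro sum_mono mult_left_mono) auto
  moreover have "?q K * (\<Sum>k\<in>{K<..D}. p k) \<le> ?q K"
    using q pD by (intro mult_left_le) auto
  ultimately show "?L - ?R \<le> ?q K" using pK[of K] split by linarith
qed

text \<open>
  The value of the Chernoff bound for a Poisson variable of mean \<open>c (1 + d)\<close> on the wrong side of
  \<open>c\<close>, at the optimal parameter \<open>s = 1 / (1 + d)\<close>.
\<close>

definition chernoff_err :: "real \<Rightarrow> real \<Rightarrow> real" where
  "chernoff_err c d = exp (- c * (d - ln (1 + d)))"

lemma chernoff_err_eq:
  assumes "d > -1" "c = real K"
  shows "exp (c * (1 + d) * (1 / (1 + d)) - c * (1 + d)) / (1 / (1 + d)) ^ K = chernoff_err c d"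
proof -
  have "(1 + d) ^ K = exp (c * ln (1 + d))"
    using assms by (simp add: exp_of_nat_mult)
  then have "exp (c * (1 + d) * (1 / (1 + d)) - c * (1 + d)) / (1 / (1 + d)) ^ K
      = exp (c - c * (1 + d)) * exp (c * ln (1 + d))"
    using assms(1) by (simp add: power_one_over)
  then show ?thesis
    by (simp add: chernoff_err_def algebra_simps flip: exp_add)
qed

text \<open>A mean \<open>k * (1 + d)\<close> makes a total of at most \<open>k\<close> balls
  unlikely. The upper bound after it takes the mean \<open>k * (1 - d)\<close>, which makes more
  than \<open>k\<close> balls unlikely.\<close>

lemma cells_le_prob_lower:
  assumes "n > 0" "l > 0" "0 \<le> d" "real k = l * real n"
  shows "(1 - poisson_tail (l * (1 + d)) m) ^ n - chernoff_err (real k) d \<le> cells_le_prob n k m"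
proof -
  have "1 - poisson_tail (real n * (l * (1 + d))) k \<le> chernoff_err (real k) d"
    using poisson_lower_tail_chernoff[of "real k * (1 + d)" "1 / (1 + d)" k]
      chernoff_err_eq[of d "real k" k] assms by (simp add: ac_simps)
  then show ?thesis using poissonization_bounds(1)[of n "l * (1 + d)" m k] assms by simp
qed

lemma cells_le_prob_upper:
  assumes "n > 0" "l > 0" "0 \<le> d" "d < 1" "real k = l * real n"
  shows "cells_le_prob n k m * (1 - chernoff_err (real k) (- d)) \<le> (1 - poisson_tail (l * (1 - d)) m) ^ n"
proof -
  have "poisson_tail (real n * (l * (1 - d))) k \<le> chernoff_err (real k) (- d)"
    using poisson_upper_tail_chernoff[of "real k * (1 - d)" "1 / (1 - d)" k]
      chernoff_err_eq[of "- d" "real k" k] assms by (simp add: ac_simps)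
  then have "cells_le_prob n k m * (1 - chernoff_err (real k) (- d))
    \<le> cells_le_prob n k m * (1 - poisson_tail (real n * (l * (1 - d))) k)"
    by (intro mult_left_mono cells_le_prob_nonneg) simp
  also have "\<dots> \<le> (1 - poisson_tail (l * (1 - d)) m) ^ n"
    using poissonization_bounds(2)[of n "l * (1 - d)" k m] assms by simp
  finally show ?thesis .
qed

section \<open>Explicit bounds for a fixed number of balls\<close>

context
  fixes l d :: real and n k m :: nat
  assumes l: "0 < l" and d: "0 \<le> d" "d < 1" and n: "0 < n" and k: "real k = l * real n"
begin

lemma cells_le_prob_le_exp:
  assumes "chernoff_err (l * real n) (- d) < 1"
  shows "cells_le_prob n k m
    \<le> exp (- (real n * poisson_tail l m * (1 - perturb_err l d m))) / (1 - chernoff_err (l * real n) (- d))"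
proof -
  have T: "0 \<le> poisson_tail (l * (1 - d)) m" "poisson_tail (l * (1 - d)) m \<le> 1"
    using l d poisson_tail_nonneg poisson_tail_le_1 by auto
  have "cells_le_prob n k m * (1 - chernoff_err (l * real n) (- d)) \<le> (1 - poisson_tail (l * (1 - d)) m) ^ n"
    using cells_le_prob_upper[OF n l d k] k by simp
  also have "\<dots> \<le> exp (- poisson_tail (l * (1 - d)) m) ^ n"
    using T exp_ge_add_one_self[of "- poisson_tail (l * (1 - d)) m"] by (intro power_mono) auto
  also have "\<dots> = exp (- (real n * poisson_tail (l * (1 - d)) m))"
    by (simp flip: exp_of_nat_mult)
  also have "\<dots> \<le> exp (- (real n * poisson_tail l m * (1 - perturb_err l d m)))"
    using poisson_tail_perturb(2)[OF l d, of m] by (simp add: mult.assoc mult_left_mono)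
  finally show ?thesis using assms by (simp add: field_simps)
qed

text \<open>Reverses \<open>1 - T \<le> exp (- T)\<close> at the cost of a quadratic term, valid for
  \<open>T \<le> 1 / 2\<close>; over \<open>n\<close> factors it amounts to at most
  \<open>2 * t\<^sup>2 / n\<close>.\<close>

lemma cells_le_prob_ge_exp:
  defines "t \<equiv> real n * poisson_tail l m * (1 + perturb_err l d m)"
  assumes "t / real n \<le> 1 / 2"
  shows "exp (- t - 2 * t\<^sup>2 / real n) - chernoff_err (l * real n) d \<le> cells_le_prob n k m"
proof -
  define T where "T = poisson_tail (l * (1 + d)) m"
  have T0: "0 \<le> T" using l d by (simp add: T_def poisson_tail_nonneg)
  have Tt: "real n * T \<le> t"
    using poisson_tail_perturb(1)[OF l d, of m] by (simp add: T_def t_def mult.assoc mult_left_mono)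
  then have "T \<le> t / real n" using n by (simp add: field_simps)
  then have T1: "T \<le> 1 / 2" using assms(2) by linarith
  have "(real n * T)\<^sup>2 \<le> t\<^sup>2" using Tt T0 by (intro power_mono) auto
  then have "(real n * T)\<^sup>2 / real n \<le> t\<^sup>2 / real n" by (intro divide_right_mono) auto
  then have "real n * T\<^sup>2 \<le> t\<^sup>2 / real n" using n by (simp add: power2_eq_square ac_simps)
  then have "exp (- t - 2 * t\<^sup>2 / real n) \<le> exp (real n * (- T - 2 * T\<^sup>2))"
    using Tt by (simp add: algebra_simps)
  also have "\<dots> = exp (- T - 2 * T\<^sup>2) ^ n" by (simp add: exp_of_nat_mult)
  also have "\<dots> \<le> (1 - T) ^ n"
  proof (rule power_mono)
    have "exp (- T - 2 * T\<^sup>2) \<le> exp (ln (1 - T))"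
      unfolding exp_le_cancel_iff by (rule ln_one_minus_pos_lower_bound[OF T0 T1])
    then show "exp (- T - 2 * T\<^sup>2) \<le> 1 - T" using T1 by simp
  qed simp
  also have "\<dots> \<le> cells_le_prob n k m + chernoff_err (l * real n) d"
    using cells_le_prob_lower[OF n l d(1) k, of m] k by (simp add: T_def)
  finally show ?thesis by simp
qed

text \<open>Bernoulli's inequality gives a bound linear in the tail, which survives division by a
  small \<open>\<theta>\<close> in \<open>cells_le_prob_Suc_limit\<close>.\<close>

lemma one_minus_cells_le_prob_le:
  "1 - cells_le_prob n k m
    \<le> real n * poisson_tail l m * (1 + perturb_err l d m) + chernoff_err (l * real n) d"
proof -
  define T where "T = poisson_tail (l * (1 + d)) m"
  have "0 \<le> T" "T \<le> 1" using l d by (simp_all add: T_def poisson_tail_nonneg poisson_tail_le_1)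
  then have "1 - real n * T \<le> (1 - T) ^ n"
    using Bernoulli_inequality[of "- T" n] by simp
  moreover have "(1 - T) ^ n \<le> cells_le_prob n k m + chernoff_err (l * real n) d"
    using cells_le_prob_lower[OF n l d(1) k, of m] k by (simp add: T_def)
  moreover have "real n * T \<le> real n * poisson_tail l m * (1 + perturb_err l d m)"
    using poisson_tail_perturb(1)[OF l d, of m] by (simp add: T_def mult.assoc mult_left_mono)
  ultimately show ?thesis by linarith
qed

end

text \<open>Everything is expressed in \<open>n\<close> alone: \<open>ln n\<close> later bounds
  \<open>m\<close>, \<open>\<theta>\<close> and \<open>1 / \<theta>\<close>, and the argument
  \<open>ln n + 1\<close> also covers \<open>m + 1\<close>. The last two limits are the two sides of
  the sandwich in \<open>cells_le_prob_limit\<close>.\<close>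

lemma error_terms_tendsto_0:
  fixes l :: real
  assumes l: "0 < l"
  defines "d \<equiv> \<lambda>n. real n powr (- 1 / 3)"
  defines "H \<equiv> \<lambda>n. perturb_err l (d n) (ln (real n) + 1)"
  shows "H \<longlonglongrightarrow> 0"
    and "(\<lambda>n. ln (real n) * (1 + H n) / real n) \<longlonglongrightarrow> 0"
    and "(\<lambda>n. chernoff_err (l * real n) (d n) * (1 + ln (real n))) \<longlonglongrightarrow> 0"
    and "(\<lambda>n. chernoff_err (l * real n) (- d n)) \<longlonglongrightarrow> 0"
    and "(\<lambda>n. (exp (ln (real n) * H n) / (1 - chernoff_err (l * real n) (- d n)) - 1) * ln (real n)) \<longlonglongrightarrow> 0"
    and "(\<lambda>n. (exp (- (ln (real n) * H n) - 2 * (ln (real n) * (1 + H n))\<^sup>2 / real n)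
            - chernoff_err (l * real n) (d n) * real n - 1) * ln (real n)) \<longlonglongrightarrow> 0"
  unfolding H_def d_def perturb_err_def chernoff_err_def
  using l by real_asymp+

section \<open>Limits of the occupancy probabilities near the level \<open>m\<close>\<close>

context
  fixes l :: real and F :: "'i filter" and n k m :: "'i \<Rightarrow> nat" and \<theta> :: "'i \<Rightarrow> real"
  assumes l: "0 < l"
    and n: "filterlim n at_top F"
    and k: "\<forall>\<^sub>F j in F. real (k j) = l * real (n j)"
    and m: "filterlim m at_top F"
    and m_le: "\<forall>\<^sub>F j in F. real (m j) \<le> ln (real (n j))"
    and \<theta>: "\<forall>\<^sub>F j in F. \<theta> j = real (n j) * poisson_tail l (m j)"
    and \<theta>_lower: "\<forall>\<^sub>F j in F. exp (- l) * l / (real (m j) + 2) \<le> (\<theta> j)\<^sup>2"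
    and \<theta>_upper: "\<forall>\<^sub>F j in F. (\<theta> j)\<^sup>2 \<le> exp l * (real (m j) + 3) / l"
begin

lemma eventually_of_m:
  "\<forall>\<^sub>F x in at_top. P x \<Longrightarrow> \<forall>\<^sub>F j in F. P (real (m j))" for P :: "real \<Rightarrow> bool"
  by (rule eventually_compose_filterlim[OF _ filterlim_compose[OF filterlim_real_sequentially m]])

text \<open>For large \<open>m\<close>, the constants in the bounds of order \<open>1 / m\<close>
  and \<open>m\<close> on \<open>\<theta>\<^sup>2\<close> are absorbed by passing to
  \<open>1 / m\<^sup>2\<close> and \<open>m\<^sup>2\<close>. Together with
  \<open>m \<le> ln n\<close> this controls \<open>\<theta>\<close> and \<open>1 / \<theta>\<close>
  by \<open>ln n\<close>.\<close>

lemma eventually_\<theta>_between: "\<forall>\<^sub>F j in F. 0 < \<theta> j \<and> 1 / \<theta> j \<le> real (m j) \<and> \<theta> j \<le> real (m j) \<and> 1 \<le> real (m j)"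
proof -
  have "\<forall>\<^sub>F x in at_top. (1 / x)\<^sup>2 \<le> exp (- l) * l / (x + 2)"
    "\<forall>\<^sub>F x in at_top. exp l * (x + 3) / l \<le> x\<^sup>2" "\<forall>\<^sub>F x::real in at_top. 1 \<le> x"
    using l by real_asymp+
  from this[THEN eventually_of_m] show ?thesis
    using \<theta> \<theta>_lower \<theta>_upper
  proof eventually_elim
    case (elim j)
    have \<theta>0: "0 \<le> \<theta> j" using elim l by (simp add: poisson_tail_nonneg)
    have "(1 / real (m j))\<^sup>2 \<le> (\<theta> j)\<^sup>2" using elim by linarith
    then have ge: "1 / real (m j) \<le> \<theta> j" using \<theta>0 by (rule power2_le_imp_le)
    have "0 < 1 / real (m j)" using elim by simp
    with ge have pos: "0 < \<theta> j" by linarith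
    have "1 \<le> \<theta> j * real (m j)" using ge elim by (subst (asm) pos_divide_le_eq) auto
    then have "1 / \<theta> j \<le> real (m j)" using pos by (simp add: pos_divide_le_eq mult.commute)
    moreover have "(\<theta> j)\<^sup>2 \<le> (real (m j))\<^sup>2" using elim by linarith
    then have "\<theta> j \<le> real (m j)" by (rule power2_le_imp_le) simp
    ultimately show ?case using pos elim by blast
  qed
qed

text \<open>
  The gap is large compared with \<open>n\<^sup>-\<^sup>1\<^sup>/\<^sup>2\<close>, so that the Chernoff errors are negligible, and small
  compared with all powers of \<open>1 / ln n\<close>, so that the Poisson tail at \<open>m\<close> is barely affected.
\<close>

definition rate_gap :: "nat \<Rightarrow> real" where "rate_gap N = real N powr (- 1 / 3)"
definition rate_gap_err :: "nat \<Rightarrow> real" where "rate_gap_err N = perturb_err l (rate_gap N) (ln (real N) + 1)"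

lemmas error_terms = error_terms_tendsto_0[OF l, folded rate_gap_def, folded rate_gap_err_def]
lemmas error_limits = error_terms[THEN filterlim_compose, OF n]

lemma eventually_small_errors:
  "\<forall>\<^sub>F j in F. 2 \<le> n j \<and> 0 \<le> rate_gap (n j) \<and> rate_gap (n j) < 1 \<and> 0 \<le> rate_gap_err (n j) \<and> rate_gap_err (n j) \<le> 1 / 2 \<and>
     1 \<le> ln (real (n j)) \<and> ln (real (n j)) * (1 + rate_gap_err (n j)) / real (n j) \<le> 1 / 2 \<and>
     chernoff_err (l * real (n j)) (- rate_gap (n j)) \<le> 1 / 2"
proof -
  have "\<forall>\<^sub>F N in sequentially. rate_gap N < 1" "\<forall>\<^sub>F N in sequentially. 1 \<le> ln (real N)"
    unfolding rate_gap_def by real_asymp+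
  moreover have "\<forall>\<^sub>F N in sequentially. rate_gap_err N < 1 / 2"
    "\<forall>\<^sub>F N in sequentially. ln (real N) * (1 + rate_gap_err N) / real N < 1 / 2"
    "\<forall>\<^sub>F N in sequentially. chernoff_err (l * real N) (- rate_gap N) < 1 / 2"
    by (rule order_tendstoD(2)[OF error_terms(1)] order_tendstoD(2)[OF error_terms(2)]
        order_tendstoD(2)[OF error_terms(4)], simp)+
  ultimately have "\<forall>\<^sub>F N in sequentially. 2 \<le> N \<and> 0 \<le> rate_gap N \<and> rate_gap N < 1 \<and> 0 \<le> rate_gap_err N \<and> rate_gap_err N \<le> 1 / 2 \<and>
     1 \<le> ln (real N) \<and> ln (real N) * (1 + rate_gap_err N) / real N \<le> 1 / 2 \<and>
     chernoff_err (l * real N) (- rate_gap N) \<le> 1 / 2"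
    using eventually_ge_at_top[of 2]
    by eventually_elim (auto simp: rate_gap_err_def rate_gap_def intro!: perturb_err_nonneg)
  then show ?thesis by (rule eventually_compose_filterlim[OF _ n])
qed

text \<open>
  The factor \<open>ln n\<close> dominates \<open>1 / \<theta>\<close>; it is needed because \<open>1 - exp (- \<theta>)\<close> may tend to \<open>0\<close>.
\<close>

lemma cells_le_prob_limit:
  "((\<lambda>j. (cells_le_prob (n j) (k j) (m j) * exp (\<theta> j) - 1) * ln (real (n j))) \<longlongrightarrow> 0) F"
proof (rule tendsto_sandwich[OF _ _ error_limits(6,5)])
  show "\<forall>\<^sub>F j in F. (cells_le_prob (n j) (k j) (m j) * exp (\<theta> j) - 1) * ln (real (n j))
    \<le> (exp (ln (real (n j)) * rate_gap_err (n j)) / (1 - chernoff_err (l * real (n j)) (- rate_gap (n j))) - 1) * ln (real (n j))"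
    using eventually_\<theta>_between eventually_small_errors k m_le \<theta>
  proof eventually_elim
    case (elim j)
    let ?\<eta> = "perturb_err l (rate_gap (n j)) (m j)" and ?e = "chernoff_err (l * real (n j)) (- rate_gap (n j))"
    have "0 \<le> ?\<eta>" "?\<eta> \<le> rate_gap_err (n j)"
      unfolding rate_gap_err_def using elim by (auto intro!: perturb_err_nonneg perturb_err_mono)
    then have "\<theta> j * ?\<eta> \<le> ln (real (n j)) * rate_gap_err (n j)"
      using elim by (intro mult_mono) auto
    then have *: "exp (- (\<theta> j * (1 - ?\<eta>))) * exp (\<theta> j) \<le> exp (ln (real (n j)) * rate_gap_err (n j))"
      by (simp add: algebra_simps flip: exp_add)
    have "cells_le_prob (n j) (k j) (m j) \<le> exp (- (\<theta> j * (1 - ?\<eta>))) / (1 - ?e)"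
      using cells_le_prob_le_exp[OF l, of "rate_gap (n j)" "n j" "k j" "m j"] elim by simp
    then have "cells_le_prob (n j) (k j) (m j) * exp (\<theta> j)
        \<le> exp (- (\<theta> j * (1 - ?\<eta>))) / (1 - ?e) * exp (\<theta> j)"
      by (rule mult_right_mono) simp
    also have "\<dots> \<le> exp (ln (real (n j)) * rate_gap_err (n j)) / (1 - ?e)"
      using * elim by (simp add: divide_right_mono)
    finally show ?case using elim by (intro mult_right_mono) auto
  qed
  show "\<forall>\<^sub>F j in F. (exp (- (ln (real (n j)) * rate_gap_err (n j)) - 2 * (ln (real (n j)) * (1 + rate_gap_err (n j)))\<^sup>2 / real (n j))
            - chernoff_err (l * real (n j)) (rate_gap (n j)) * real (n j) - 1) * ln (real (n j))
    \<le> (cells_le_prob (n j) (k j) (m j) * exp (\<theta> j) - 1) * ln (real (n j))"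
    using eventually_\<theta>_between eventually_small_errors k m_le \<theta>
  proof eventually_elim
    case (elim j)
    let ?\<eta> = "perturb_err l (rate_gap (n j)) (m j)" and ?e = "chernoff_err (l * real (n j)) (rate_gap (n j))"
    define t where "t = \<theta> j * (1 + ?\<eta>)"
    define L where "L = ln (real (n j))"
    have \<theta>0: "0 \<le> \<theta> j" using elim l by (simp add: poisson_tail_nonneg)
    have \<eta>: "0 \<le> ?\<eta>" "?\<eta> \<le> rate_gap_err (n j)"
      unfolding rate_gap_err_def using elim by (auto intro!: perturb_err_nonneg perturb_err_mono)
    then have "\<theta> j * ?\<eta> \<le> L * rate_gap_err (n j)"
      unfolding L_def using elim by (intro mult_mono) auto
    moreover have tL: "t \<le> L * (1 + rate_gap_err (n j))"
      unfolding t_def L_def using elim \<eta> by (intro mult_mono) auto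
    then have "t\<^sup>2 \<le> (L * (1 + rate_gap_err (n j)))\<^sup>2"
      using \<theta>0 \<eta> by (intro power_mono) (auto simp: t_def)
    then have "2 * t\<^sup>2 / real (n j) \<le> 2 * (L * (1 + rate_gap_err (n j)))\<^sup>2 / real (n j)"
      by (intro divide_right_mono) auto
    \<comment> \<open>The exponent on the right is
      \<open>- \<theta> * \<eta> - 2 * t\<^sup>2 / n\<close>, since
      \<open>t = \<theta> + \<theta> * \<eta>\<close>.\<close>
    ultimately have "exp (- (L * rate_gap_err (n j)) - 2 * (L * (1 + rate_gap_err (n j)))\<^sup>2 / real (n j))
        \<le> exp (- t - 2 * t\<^sup>2 / real (n j) + \<theta> j)"
      unfolding exp_le_cancel_iff t_def ring_distribs by linarith
    \<comment> \<open>As \<open>\<theta> \<le> m \<le> ln n\<close>, multiplying by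
      \<open>exp \<theta>\<close> costs at most a factor \<open>n\<close>, which the Chernoff error
      absorbs.\<close>
    moreover have "exp (\<theta> j) \<le> exp L"
      unfolding exp_le_cancel_iff L_def using elim by linarith
    then have "?e * exp (\<theta> j) \<le> ?e * real (n j)"
      using elim by (intro mult_left_mono) (auto simp: L_def chernoff_err_def)
    ultimately have "exp (- (L * rate_gap_err (n j)) - 2 * (L * (1 + rate_gap_err (n j)))\<^sup>2 / real (n j)) - ?e * real (n j)
        \<le> (exp (- t - 2 * t\<^sup>2 / real (n j)) - ?e) * exp (\<theta> j)"
      unfolding left_diff_distrib exp_add by linarith
    also have "exp (- t - 2 * t\<^sup>2 / real (n j)) - ?e \<le> cells_le_prob (n j) (k j) (m j)"
    proof -
      have "t / real (n j) \<le> L * (1 + rate_gap_err (n j)) / real (n j)"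
        using tL by (intro divide_right_mono) auto
      also have "\<dots> \<le> 1 / 2" unfolding L_def using elim by blast
      finally have "t / real (n j) \<le> 1 / 2" .
      then show ?thesis
        using cells_le_prob_ge_exp[OF l, of "rate_gap (n j)" "n j" "k j" "m j"] elim
        by (simp add: t_def)
    qed
    finally show ?case
      unfolding L_def using elim by (intro mult_right_mono) auto
  qed
qed

text \<open>Lowering the level by one multiplies the tail by at least a factor \<open>y\<close> of
  order \<open>m\<close>, so the probability is at most \<open>2 * exp (- \<theta> * y / 2)\<close>.
  The product \<open>\<theta> * y\<close> is at least of order \<open>sqrt m\<close>.\<close>

lemma cells_le_prob_pred_limit:
  "((\<lambda>j. cells_le_prob (n j) (k j) (m j - 1) * exp (\<theta> j)) \<longlongrightarrow> 0) F"
proof (rule tendsto_sandwich[OF _ _ tendsto_const])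
  let ?c = "exp l * l" and ?g = "\<lambda>x. 2 * exp (- (sqrt (exp (- l) * l / (x + 2)) * (x + 1) / (4 * (exp l * l))))"
  have c: "?c > 0" using l by simp
  then have "(?g \<longlongrightarrow> 0) at_top" using l by real_asymp
  then show "((\<lambda>j. ?g (real (m j))) \<longlongrightarrow> 0) F"
    by (rule filterlim_compose[OF _ filterlim_compose[OF filterlim_real_sequentially m]])
  have "\<forall>\<^sub>F x in at_top. 4 \<le> (x + 1) / ?c" using l by real_asymp
  from this[THEN eventually_of_m]
  show "\<forall>\<^sub>F j in F. cells_le_prob (n j) (k j) (m j - 1) * exp (\<theta> j) \<le> ?g (real (m j))"
    using eventually_\<theta>_between eventually_small_errors k m_le \<theta> \<theta>_lower
  proof eventually_elim
    case (elim j)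
    let ?e = "chernoff_err (l * real (n j)) (- rate_gap (n j))"
    define M where "M = m j - 1"
    have M: "m j = Suc M" using elim by (simp add: M_def)
    define y where "y = (real (m j) + 1) / ?c"
    let ?\<eta> = "perturb_err l (rate_gap (n j)) M"
    have \<theta>0: "0 \<le> \<theta> j" using elim l by (simp add: poisson_tail_nonneg)
    have "?\<eta> \<le> rate_gap_err (n j)"
      unfolding rate_gap_err_def using elim M by (intro perturb_err_mono) auto
    then have \<eta>: "?\<eta> \<le> 1 / 2" using elim by simp
    have "y * poisson_tail l (m j) \<le> poisson_tail l M"
      using poisson_tail_ratio(2)[OF l, of M] c by (simp add: y_def M field_simps)
    then have "\<theta> j * y \<le> real (n j) * poisson_tail l M"
      using elim by (simp add: mult.assoc mult.commute[of _ y] mult_left_mono)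
    then have "\<theta> j * y * (1 / 2) \<le> real (n j) * poisson_tail l M * (1 - ?\<eta>)"
      by (rule mult_mono) (use \<eta> l in \<open>auto simp: poisson_tail_nonneg\<close>)
    then have "exp (- (real (n j) * poisson_tail l M * (1 - ?\<eta>))) \<le> exp (- (\<theta> j * y / 2))" (is "?E \<le> _")
      by simp
    then have *: "2 * ?E \<le> 2 * exp (- (\<theta> j * y / 2))"
      by (rule mult_left_mono) simp
    have "cells_le_prob (n j) (k j) M
        \<le> exp (- (real (n j) * poisson_tail l M * (1 - ?\<eta>))) / (1 - ?e)"
      using cells_le_prob_le_exp[OF l, of "rate_gap (n j)" "n j" "k j" M] elim by simp
    also have "\<dots> \<le> ?E / (1 / 2)"
      using elim by (intro divide_left_mono) auto
    also have "\<dots> = 2 * ?E" by simp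
    also note *
    finally have "cells_le_prob (n j) (k j) M * exp (\<theta> j) \<le> 2 * exp (- (\<theta> j * y / 2)) * exp (\<theta> j)"
      by (intro mult_right_mono) auto
    also have "\<dots> = 2 * exp (\<theta> j - \<theta> j * y / 2)"
      unfolding mult.assoc exp_add[symmetric] by simp
    \<comment> \<open>With \<open>y \<ge> 4\<close>, half of the exponent
      \<open>\<theta> * y / 2\<close> pays for the factor \<open>exp \<theta>\<close>.\<close>
    also have "\<theta> j * 4 \<le> \<theta> j * y"
      using elim \<theta>0 by (intro mult_left_mono) (auto simp: y_def)
    then have "2 * exp (\<theta> j - \<theta> j * y / 2) \<le> 2 * exp (- (\<theta> j * y / 4))" by simp
    also have "sqrt (exp (- l) * l / (real (m j) + 2)) * y \<le> \<theta> j * y"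
      using elim \<theta>0 c by (intro mult_right_mono real_le_lsqrt) (auto simp: y_def)
    then have "2 * exp (- (\<theta> j * y / 4)) \<le> ?g (real (m j))"
      by (simp add: y_def)
    finally show ?case by (simp add: M_def)
  qed
qed (simp add: cells_le_prob_nonneg)

text \<open>The factor \<open>1 + 1 / \<theta>\<close> dominates
  \<open>1 / (1 - exp (- \<theta>))\<close>. One level up, the tail shrinks by a factor of order
  \<open>1 / m\<close>, so the main term is of order \<open>(\<theta> + 1) / m\<close>, and
  \<open>\<theta>\<close> is at most of order \<open>sqrt m\<close>.\<close>

lemma cells_le_prob_Suc_limit:
  "((\<lambda>j. (1 - cells_le_prob (n j) (k j) (Suc (m j))) * (1 + 1 / \<theta> j)) \<longlongrightarrow> 0) F"
proof (rule tendsto_sandwich[OF _ _ tendsto_const])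
  let ?g = "\<lambda>x. 2 * (sqrt (exp l * (x + 3) / l) + 1) * (exp l * l / (x + 2))"
  let ?e = "\<lambda>j. chernoff_err (l * real (n j)) (rate_gap (n j))"
  have "(?g \<longlongrightarrow> 0) at_top" using l by real_asymp
  then have "((\<lambda>j. ?g (real (m j))) \<longlongrightarrow> 0) F"
    by (rule filterlim_compose[OF _ filterlim_compose[OF filterlim_real_sequentially m]])
  from tendsto_add[OF this error_limits(3)]
  show "((\<lambda>j. ?g (real (m j)) + ?e j * (1 + ln (real (n j)))) \<longlongrightarrow> 0) F" by simp
  show "\<forall>\<^sub>F j in F. (1 - cells_le_prob (n j) (k j) (Suc (m j))) * (1 + 1 / \<theta> j)
      \<le> ?g (real (m j)) + ?e j * (1 + ln (real (n j)))"
    using eventually_\<theta>_between eventually_small_errors k m_le \<theta> \<theta>_upper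
  proof eventually_elim
    case (elim j)
    let ?\<eta> = "perturb_err l (rate_gap (n j)) (Suc (m j))" and ?r = "exp l * l / (real (m j) + 2)"
    have \<theta>0: "0 < \<theta> j" using elim by blast
    have "?\<eta> \<le> rate_gap_err (n j)"
      unfolding rate_gap_err_def using elim by (intro perturb_err_mono) auto
    then have \<eta>: "1 + ?\<eta> \<le> 2" using elim by simp
    have "real (n j) * poisson_tail l (Suc (m j)) \<le> real (n j) * (?r * poisson_tail l (m j))"
      using poisson_tail_ratio(2)[OF l, of "m j"] by (intro mult_left_mono) auto
    also have "\<dots> = ?r * \<theta> j" using elim by simp
    finally have "real (n j) * poisson_tail l (Suc (m j)) * (1 + ?\<eta>) \<le> ?r * \<theta> j * 2"
    proof (rule mult_mono[OF _ \<eta>])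
      show "0 \<le> ?r * \<theta> j" using \<theta>0 l by simp
      show "0 \<le> 1 + ?\<eta>" using perturb_err_nonneg[of "rate_gap (n j)" "real (Suc (m j))" l] elim by simp
    qed
    then have "1 - cells_le_prob (n j) (k j) (Suc (m j)) \<le> ?r * \<theta> j * 2 + ?e j"
      using one_minus_cells_le_prob_le[OF l, of "rate_gap (n j)" "n j" "k j" "Suc (m j)"] elim by simp
    then have "(1 - cells_le_prob (n j) (k j) (Suc (m j))) * (1 + 1 / \<theta> j)
        \<le> (?r * \<theta> j * 2 + ?e j) * (1 + 1 / \<theta> j)"
      using \<theta>0 by (intro mult_right_mono) auto
    also have "\<dots> = 2 * (\<theta> j + 1) * ?r + ?e j * (1 + 1 / \<theta> j)"
      using \<theta>0 by (simp add: field_simps)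
    also have "\<dots> \<le> ?g (real (m j)) + ?e j * (1 + ln (real (n j)))"
    proof (rule add_mono)
      have "\<theta> j \<le> sqrt (exp l * (real (m j) + 3) / l)"
        using elim by (intro real_le_rsqrt)
      then show "2 * (\<theta> j + 1) * ?r \<le> ?g (real (m j))"
        using l by (intro mult_right_mono) auto
      show "?e j * (1 + 1 / \<theta> j) \<le> ?e j * (1 + ln (real (n j)))"
        using elim by (intro mult_left_mono) (auto simp: chernoff_err_def)
    qed
    finally show ?case .
  qed
  show "\<forall>\<^sub>F j in F. 0 \<le> (1 - cells_le_prob (n j) (k j) (Suc (m j))) * (1 + 1 / \<theta> j)"
    using eventually_\<theta>_between eventually_small_errors
  proof eventually_elim
    case (elim j)
    then show ?case
      using cells_le_prob_le_1[of "n j"] elim by (intro mult_nonneg_nonneg) auto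
  qed
qed

lemma cells_le_prob_tendsto:
  "((\<lambda>j. cells_le_prob (n j) (k j) (m j) * exp (\<theta> j)) \<longlongrightarrow> 1) F"
proof -
  have "((\<lambda>j. cells_le_prob (n j) (k j) (m j) * exp (\<theta> j) - 1) \<longlongrightarrow> 0) F"
  proof (rule Lim_null_comparison[OF _ tendsto_rabs_zero[OF cells_le_prob_limit]])
    show "\<forall>\<^sub>F j in F. norm (cells_le_prob (n j) (k j) (m j) * exp (\<theta> j) - 1)
        \<le> \<bar>(cells_le_prob (n j) (k j) (m j) * exp (\<theta> j) - 1) * ln (real (n j))\<bar>"
      using eventually_small_errors
      by eventually_elim (simp add: abs_mult mult_left_le mult_le_cancel_left1)
  qed
  then show ?thesis by (simp add: LIM_zero_iff)
qed

lemma max_eq_m_asymp: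
  "((\<lambda>j. (cells_le_prob (n j) (k j) (m j) - cells_le_prob (n j) (k j) (m j - 1)) / exp (- \<theta> j)) \<longlongrightarrow> 1) F"
  using tendsto_diff[OF cells_le_prob_tendsto cells_le_prob_pred_limit]
  by (simp add: exp_minus field_simps)

text \<open>The quotient equals \<open>1 + (1 - q m * exp \<theta>) / (exp \<theta> - 1) - (1 - q (m
  + 1)) / (1 - exp (- \<theta>))\<close>. A small \<open>\<theta>\<close> inflates the corrections
  by at most \<open>ln n\<close> and \<open>1 + 1 / \<theta>\<close>, the weights built into the
  limits above.\<close>

lemma max_eq_Suc_m_asymp:
  "((\<lambda>j. (cells_le_prob (n j) (k j) (Suc (m j)) - cells_le_prob (n j) (k j) (m j)) / (1 - exp (- \<theta> j))) \<longlongrightarrow> 1) F"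
proof -
  let ?q = "\<lambda>j. cells_le_prob (n j) (k j)"
  have bounds: "\<forall>\<^sub>F j in F. 0 < \<theta> j \<and> 1 / (exp (\<theta> j) - 1) \<le> ln (real (n j)) \<and> 1 / (1 - exp (- \<theta> j)) \<le> 1 + 1 / \<theta> j \<and> 0 < n j"
    using eventually_\<theta>_between eventually_small_errors m_le
  proof eventually_elim
    case (elim j)
    have \<theta>0: "0 < \<theta> j" using elim by blast
    have e: "\<theta> j \<le> exp (\<theta> j) - 1" using exp_ge_add_one_self[of "\<theta> j"] by linarith
    then have "1 / (exp (\<theta> j) - 1) \<le> 1 / \<theta> j"
      using \<theta>0 by (intro divide_left_mono) auto
    also have "\<dots> \<le> real (m j)" using elim by blast
    finally have "1 / (exp (\<theta> j) - 1) \<le> ln (real (n j))" using elim by linarith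
    moreover have "1 / (1 - exp (- \<theta> j)) = 1 + 1 / (exp (\<theta> j) - 1)"
      using e \<theta>0 by (simp add: exp_minus divide_simps)
    ultimately show ?case
      using \<theta>0 elim \<open>1 / (exp (\<theta> j) - 1) \<le> 1 / \<theta> j\<close> by simp
  qed
  have "((\<lambda>j. (1 - ?q j (m j) * exp (\<theta> j)) * (1 / (exp (\<theta> j) - 1))) \<longlongrightarrow> 0) F"
  proof (rule Lim_null_comparison[OF _ tendsto_rabs_zero[OF cells_le_prob_limit]])
    show "\<forall>\<^sub>F j in F. norm ((1 - ?q j (m j) * exp (\<theta> j)) * (1 / (exp (\<theta> j) - 1)))
        \<le> \<bar>(?q j (m j) * exp (\<theta> j) - 1) * ln (real (n j))\<bar>"
      using bounds
    proof eventually_elim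
      case (elim j)
      then have "0 \<le> 1 / (exp (\<theta> j) - 1)" by simp
      then have "\<bar>1 / (exp (\<theta> j) - 1)\<bar> \<le> \<bar>ln (real (n j))\<bar>" using elim by linarith
      then show ?case
        unfolding real_norm_def abs_mult abs_minus_commute[of 1]
        by (intro mult_mono) auto
    qed
  qed
  moreover have "((\<lambda>j. (1 - ?q j (Suc (m j))) * (1 / (1 - exp (- \<theta> j)))) \<longlongrightarrow> 0) F"
  proof (rule Lim_null_comparison[OF _ cells_le_prob_Suc_limit])
    show "\<forall>\<^sub>F j in F. norm ((1 - ?q j (Suc (m j))) * (1 / (1 - exp (- \<theta> j))))
        \<le> (1 - ?q j (Suc (m j))) * (1 + 1 / \<theta> j)"
      using bounds
    proof eventually_elim
      case (elim j)
      have "0 \<le> 1 - ?q j (Suc (m j))" using cells_le_prob_le_1[of "n j"] elim by simp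
      moreover have "0 \<le> 1 / (1 - exp (- \<theta> j))" using elim by simp
      ultimately show ?case
        unfolding real_norm_def abs_mult using elim by (intro mult_mono) auto
    qed
  qed
  ultimately have "((\<lambda>j. 1 + (1 - ?q j (m j) * exp (\<theta> j)) * (1 / (exp (\<theta> j) - 1))
      - (1 - ?q j (Suc (m j))) * (1 / (1 - exp (- \<theta> j)))) \<longlongrightarrow> 1 + 0 - 0) F"
    by (intro tendsto_intros)
  moreover have "\<forall>\<^sub>F j in F. 1 + (1 - ?q j (m j) * exp (\<theta> j)) * (1 / (exp (\<theta> j) - 1))
      - (1 - ?q j (Suc (m j))) * (1 / (1 - exp (- \<theta> j)))
      = (?q j (Suc (m j)) - ?q j (m j)) / (1 - exp (- \<theta> j))"
    using bounds
  proof eventually_elim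
    case (elim j)
    then have "exp (\<theta> j) - 1 \<noteq> 0" by simp
    then show ?case
      by (simp add: exp_minus divide_simps) (simp add: algebra_simps)
  qed
  ultimately show ?thesis by (simp add: tendsto_cong)
qed

end

subsection \<open>Log-concave extensions of the Poisson tail\<close>

lemma poisson_cdf_of_nat:
  assumes "0 < l"
  shows "poisson_cdf l (real m) = 1 - poisson_tail l m"
proof -
  have "poisson_cdf l (real m) = measure (measure_pmf (poisson_pmf l)) {..m}"
    by (simp add: poisson_cdf_def cdf_def2 measure_distr vimage_def atMost_def)
  then show ?thesis
    using assms
    by (simp add: measure_measure_pmf_finite poisson_tail_def sum_distrib_left mult.commute)
qed

lemma poisson_cdf_neg:
  assumes "x < 0"
  shows "poisson_cdf l x = 0"
proof -
  have "{j. real j \<le> x} = {}" using assms by auto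
  then show ?thesis
    by (simp add: poisson_cdf_def cdf_def2 measure_distr vimage_def)
qed

text \<open>Adjacent chords are compared directly; if \<open>y < u\<close>, the chord over
  \<open>[y, u]\<close> links the two.\<close>

lemma concave_on_slope_antimono:
  fixes f :: "real \<Rightarrow> real"
  assumes f: "concave_on UNIV f" and "x < y" "y \<le> u" "u < v"
  shows "(f v - f u) / (v - u) \<le> (f y - f x) / (y - x)"
proof -
  have *: "(f c - f b) / (c - b) \<le> (f b - f a) / (b - a)" if "a < b" "b < c" for a b c
  proof -
    have "convex_on UNIV (\<lambda>x. - f x)" using f by (simp add: concave_on_def)
    from convex_on_slope_le[OF this, of a c b] that
    have "(- f a - - f b) / (a - b) \<le> (- f b - - f c) / (b - c)" by simp
    with that show ?thesis
      by (simp add: divide_simps split: if_splits) (simp add: algebra_simps)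
  qed
  show ?thesis
  proof (cases "y = u")
    case False
    then show ?thesis using *[of x y u] *[of y u v] assms by simp
  qed (use *[of x y v] assms in simp)
qed

context
  fixes l :: real and G :: "real \<Rightarrow> real"
  assumes l: "0 < l" and ext: "tail_extension (poisson_cdf l) G"
begin

lemma extension_of_nat: "G (real m) = poisson_tail l m"
proof -
  have "G (of_int (int m)) = 1 - poisson_cdf l (of_int (int m))"
    using ext unfolding tail_extension_def by blast
  then show ?thesis by (simp add: poisson_cdf_of_nat l)
qed

lemma extension_minus_1: "G (- 1) = 1"
proof -
  have "G (of_int (- 1)) = 1 - poisson_cdf l (of_int (- 1))"
    using ext unfolding tail_extension_def by blast
  then show ?thesis by (simp add: poisson_cdf_neg)
qed

lemma extension_pos: "0 < G x"
  using ext by (simp add: tail_extension_def log_concave_fun_def)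

lemma extension_antimono: "x \<le> y \<Longrightarrow> G y \<le> G x"
  using ext by (simp add: tail_extension_def antimono_def)

lemma extension_slope:
  assumes "x < y" "y \<le> u" "u < v"
  shows "(ln (G v) - ln (G u)) / (v - u) \<le> (ln (G y) - ln (G x)) / (y - x)"
  using ext assms
  by (intro concave_on_slope_antimono) (auto simp: tail_extension_def log_concave_fun_def)

lemma poisson_tail_antimono: "i \<le> j \<Longrightarrow> poisson_tail l j \<le> poisson_tail l i"
  using extension_antimono[of "real i" "real j"] by (simp add: extension_of_nat)

text \<open>A flat piece of \<open>G\<close> below the value 1 lies to the right of -1, where
  \<open>G\<close> is 1. The chord of \<open>ln G\<close> from -1 to that piece falls strictly, so a
  later chord of slope 0 contradicts concavity.\<close>

lemma extension_inj:
  assumes "G x = G y" "G x < 1"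
  shows "x = y"
proof -
  have False if "x < y" "G x = G y" "G x < 1" for x y
  proof -
    have "- 1 < x"
      using that(3) extension_antimono[of x "- 1"] extension_minus_1 by force
    then have "0 \<le> ln (G x) / (x + 1)"
      using extension_slope[of "- 1" x x y] that extension_minus_1 by simp
    moreover have "ln (G x) < 0" using that extension_pos by simp
    ultimately show False using \<open>- 1 < x\<close> by (simp add: zero_le_divide_iff)
  qed
  then show ?thesis using assms by (metis linorder_neqE_linordered_idom)
qed

text \<open>\<open>G\<close> runs continuously from 1 at -1 to below \<open>1 / n\<close> at a large
  integer; \<open>n \<ge> 2\<close> puts \<open>1 / n\<close> below 1, where \<open>G\<close> is
  injective.\<close>

lemma extension_x_seq:
  assumes "n \<ge> 2"
  shows "G (x_seq G n) = 1 / real n"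
proof -
  have n: "1 / real n < 1" "0 < 1 / real n" using assms by auto
  have "\<forall>\<^sub>F m in sequentially. poisson_tail l m < 1 / real n"
    using order_tendstoD(2)[OF poisson_tail_tendsto_0] l n by simp
  then obtain N where "poisson_tail l N < 1 / real n"
    by (auto simp: eventually_sequentially)
  then have "\<exists>x. - 1 \<le> x \<and> x \<le> real N \<and> G x = 1 / real n"
    using ext n extension_minus_1 extension_of_nat
    by (intro IVT2') (auto simp: tail_extension_def intro: continuous_on_subset)
  then have "\<exists>!x. G x = 1 / real n"
    using extension_inj n by metis
  then show ?thesis unfolding x_seq_def by (rule theI')
qed

lemma eventually_m_seq_ge: "\<forall>\<^sub>F n in sequentially. int M \<le> m_seq G n"
proof -
  have "\<forall>\<^sub>F n in sequentially. 1 / real n < poisson_tail l (Suc M)"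
    using order_tendstoD(2)[OF lim_1_over_n[where 'a = real]] poisson_tail_pos[OF l] by simp
  then show ?thesis
    using eventually_ge_at_top[of 2]
  proof eventually_elim
    case (elim n)
    then have "G (x_seq G n) < G (real (Suc M))"
      by (simp only: extension_x_seq extension_of_nat)
    then have "real (Suc M) < x_seq G n"
      using extension_antimono[of "x_seq G n" "real (Suc M)"] by force
    then show ?case unfolding m_seq_def by linarith
  qed
qed

text \<open>Rounding puts \<open>x\<close> within \<open>1 / 2\<close> of \<open>m\<close>, so
  log-concavity bounds \<open>\<theta>\<close> by square roots of quotients of consecutive tails;
  squaring avoids the roots.\<close>

lemma m_seq_bounds:
  assumes "n \<ge> 2" and m: "m_seq G n = int m"
  shows "theta_seq G n = real n * poisson_tail l m"
    and "m > 0 \<Longrightarrow> 1 / real n \<le> poisson_tail l (m - 1)"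
    and "poisson_tail l (Suc m) \<le> (theta_seq G n)\<^sup>2 * poisson_tail l m"
    and "(theta_seq G n)\<^sup>2 * poisson_tail l (Suc (Suc m)) \<le> poisson_tail l (Suc m)"
proof -
  define x where "x = x_seq G n"
  define \<theta> where "\<theta> = theta_seq G n"
  have Gx: "G x = 1 / real n" using extension_x_seq assms by (simp add: x_def)
  have mx: "real m - 1 / 2 \<le> x" "x < real m + 1 / 2"
    using m unfolding m_seq_def x_def[symmetric] by linarith+
  have \<theta>: "\<theta> = G (real m) / G x" by (simp add: \<theta>_def theta_seq_def m x_def)
  show "theta_seq G n = real n * poisson_tail l m"
    using \<theta> Gx by (simp add: \<theta>_def extension_of_nat)
  show "1 / real n \<le> poisson_tail l (m - 1)" if "m > 0"
    unfolding Gx[symmetric] extension_of_nat[symmetric]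
    by (rule extension_antimono) (use mx that in \<open>simp add: of_nat_diff\<close>)
  note pos = poisson_tail_pos[OF l]
  have \<theta>0: "\<theta> > 0" using \<theta> extension_pos by simp
  have ln\<theta>: "ln \<theta> = ln (G (real m)) - ln (G x)"
    unfolding \<theta> using extension_pos by (intro ln_divide_pos)
  \<comment> \<open>By concavity, the slope of \<open>ln G\<close> between \<open>x\<close> and \<open>m\<close> is at least its slope over the next unit
    interval to the right that has integer end points, and \<open>\<bar>x - m\<bar> \<le> 1 / 2\<close>.\<close>
  have slope1: "ln (poisson_tail l (Suc m)) - ln (poisson_tail l m) \<le> 2 * ln \<theta>"
  proof (cases "x < real m")
    case True
    let ?s = "ln (poisson_tail l (Suc m)) - ln (poisson_tail l m)"
    have "?s \<le> ln \<theta> / (real m - x)"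
      using extension_slope[of x "real m" "real m" "real (Suc m)"] True
      unfolding extension_of_nat ln\<theta> by simp
    then have "?s * (real m - x) \<le> ln \<theta>" using True by (simp add: field_simps)
    moreover have "?s \<le> 0" using poisson_tail_antimono[of m "Suc m"] pos by simp
    then have "?s * (1 / 2) \<le> ?s * (real m - x)"
      using mx by (intro mult_left_mono_neg) auto
    ultimately show ?thesis by simp
  next
    case False
    then have "0 \<le> ln \<theta>"
      using extension_antimono[of "real m" x] extension_pos ln\<theta> by simp
    moreover have "ln (poisson_tail l (Suc m)) \<le> ln (poisson_tail l m)"
      using poisson_tail_antimono[of m "Suc m"] pos by simp
    ultimately show ?thesis by simp
  qed
  then have "ln (poisson_tail l (Suc m)) \<le> ln (\<theta>\<^sup>2 * poisson_tail l m)"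
    using pos \<theta>0 by (simp add: ln_mult_pos ln_realpow)
  then show "poisson_tail l (Suc m) \<le> (theta_seq G n)\<^sup>2 * poisson_tail l m"
    using pos \<theta>0 by (simp add: \<theta>_def)
  \<comment> \<open>Now \<open>x\<close> may lie inside \<open>[m, m + 1]\<close>, so the chord to
    its right is the one over \<open>[m + 1, m + 2]\<close>.\<close>
  have slope2: "2 * ln \<theta> \<le> ln (poisson_tail l (Suc m)) - ln (poisson_tail l (Suc (Suc m)))"
  proof (cases "x > real m")
    case True
    let ?s = "ln (poisson_tail l (Suc (Suc m))) - ln (poisson_tail l (Suc m))"
    have "?s \<le> - ln \<theta> / (x - real m)"
      using extension_slope[of "real m" x "real (Suc m)" "real (Suc (Suc m))"] True mx
      unfolding extension_of_nat ln\<theta> by simp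
    then have "?s * (x - real m) \<le> - ln \<theta>" using True by (simp add: field_simps)
    moreover have "?s \<le> 0" using poisson_tail_antimono[of "Suc m" "Suc (Suc m)"] pos by simp
    then have "?s * (1 / 2) \<le> ?s * (x - real m)"
      using mx by (intro mult_left_mono_neg) auto
    ultimately show ?thesis by simp
  next
    case False
    then have "ln \<theta> \<le> 0"
      using extension_antimono[of x "real m"] extension_pos ln\<theta> by simp
    moreover have "ln (poisson_tail l (Suc (Suc m))) \<le> ln (poisson_tail l (Suc m))"
      using poisson_tail_antimono[of "Suc m" "Suc (Suc m)"] pos by simp
    ultimately show ?thesis by simp
  qed
  then have "ln (\<theta>\<^sup>2 * poisson_tail l (Suc (Suc m))) \<le> ln (poisson_tail l (Suc m))"
    using pos \<theta>0 by (simp add: ln_mult_pos ln_realpow)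
  then show "(theta_seq G n)\<^sup>2 * poisson_tail l (Suc (Suc m)) \<le> poisson_tail l (Suc m)"
    using pos \<theta>0 by (simp add: \<theta>_def)
qed

end

section \<open>Growth of \<open>m_seq\<close> and size of \<open>theta_seq\<close>\<close>

context
  fixes l :: real and G :: "real \<Rightarrow> real"
  assumes l: "0 < l" and ext: "tail_extension (poisson_cdf l) G"
begin

lemma filterlim_m_seq: "filterlim (\<lambda>n. nat (m_seq G n)) at_top sequentially"
  unfolding filterlim_at_top
proof
  fix M
  show "\<forall>\<^sub>F n in sequentially. M \<le> nat (m_seq G n)"
    using eventually_m_seq_ge[OF l ext, of M] by eventually_elim linarith
qed

lemma eventually_m_seq_eq: "\<forall>\<^sub>F n in sequentially. 2 \<le> n \<and> 1 \<le> m_seq G n \<and> m_seq G n = int (nat (m_seq G n))"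
  using eventually_m_seq_ge[OF l ext, of 1] eventually_ge_at_top[of 2] by eventually_elim simp

text \<open>From \<open>1 / n \<le> poisson_tail l (m - 1) \<le> l ^ m / fact m\<close> follows
  \<open>exp m \<le> n * (exp 1 * l) ^ m / fact m\<close>, and the factor after \<open>n\<close>
  drops below 1 as \<open>m\<close> grows.\<close>

lemma eventually_m_seq_le_ln: "\<forall>\<^sub>F n in sequentially. real (nat (m_seq G n)) \<le> ln (real n)"
proof -
  have "\<forall>\<^sub>F m in sequentially. (exp 1 * l) ^ m / fact m < 1"
    by (rule order_tendstoD(2)[OF power_over_fact_tendsto_0]) simp
  then have "\<forall>\<^sub>F n in sequentially. (exp 1 * l) ^ nat (m_seq G n) / fact (nat (m_seq G n)) < 1"
    by (rule eventually_compose_filterlim[OF _ filterlim_m_seq])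
  then show ?thesis
    using eventually_m_seq_eq
  proof eventually_elim
    case (elim n)
    define m where "m = nat (m_seq G n)"
    have m: "m_seq G n = int m" "0 < m" using elim by (auto simp: m_def)
    have "1 / real n \<le> poisson_tail l (m - 1)"
      using m_seq_bounds(2)[OF l ext] elim m by blast
    also have "\<dots> \<le> l ^ m / fact m"
      using poisson_tail_upper[of l "m - 1"] l m by simp
    finally have "1 / real n * exp (real m) \<le> l ^ m / fact m * exp (real m)"
      by (rule mult_right_mono) simp
    also have "\<dots> = (exp 1 * l) ^ m / fact m"
      by (simp add: power_mult_distrib mult.commute flip: exp_of_nat_mult)
    also have "\<dots> \<le> 1" using elim by (simp add: m_def)
    finally have "exp (real m) \<le> real n" using elim by (simp add: field_simps)
    then show ?case
      using elim by (simp add: m_def[symmetric] ln_ge_iff)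
  qed
qed

text \<open>Inserts \<open>poisson_tail_ratio\<close> into \<open>m_seq_bounds\<close>. The upper
  bound uses the quotient of the tails at \<open>m + 2\<close> and \<open>m + 1\<close>, hence
  \<open>m + 3\<close>.\<close>

lemma eventually_theta_seq_bounds:
  "\<forall>\<^sub>F n in sequentially. theta_seq G n = real n * poisson_tail l (nat (m_seq G n)) \<and>
    exp (- l) * l / (real (nat (m_seq G n)) + 2) \<le> (theta_seq G n)\<^sup>2 \<and>
    (theta_seq G n)\<^sup>2 \<le> exp l * (real (nat (m_seq G n)) + 3) / l"
  using eventually_m_seq_eq
proof eventually_elim
  case (elim n)
  define m where "m = nat (m_seq G n)"
  have m: "m_seq G n = int m" "2 \<le> n" using elim by (auto simp: m_def)
  note bounds = m_seq_bounds[OF l ext m(2,1)]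
  have "exp (- l) * l / (real m + 2) * poisson_tail l m \<le> (theta_seq G n)\<^sup>2 * poisson_tail l m"
    using poisson_tail_ratio(1)[OF l, of m] bounds(3) by linarith
  then have lower: "exp (- l) * l / (real m + 2) \<le> (theta_seq G n)\<^sup>2"
    using poisson_tail_pos[OF l] by (rule mult_right_le_imp_le)
  have "(theta_seq G n)\<^sup>2 * (exp (- l) * l / (real m + 3)) * poisson_tail l (Suc m)
      \<le> (theta_seq G n)\<^sup>2 * poisson_tail l (Suc (Suc m))"
    using mult_left_mono[OF poisson_tail_ratio(1)[OF l, of "Suc m"], of "(theta_seq G n)\<^sup>2"]
    by (simp add: mult.assoc add.commute)
  also have "\<dots> \<le> 1 * poisson_tail l (Suc m)" using bounds(4) by simp
  finally have "(theta_seq G n)\<^sup>2 * (exp (- l) * l / (real m + 3)) \<le> 1"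
    using poisson_tail_pos[OF l] by (rule mult_right_le_imp_le)
  then have "(theta_seq G n)\<^sup>2 * l / (exp l * (real m + 3)) \<le> 1"
    by (simp add: exp_minus divide_inverse ac_simps)
  then have "(theta_seq G n)\<^sup>2 \<le> exp l * (real m + 3) / l"
    using l by (simp add: pos_divide_le_eq pos_le_divide_eq)
  with lower bounds(1) show ?case by (simp add: m_def)
qed

end

theorem theorem1p5:
  fixes l :: real
    and k n :: "nat \<Rightarrow> nat"
    and M :: "nat \<Rightarrow> 'a measure"
    and Y :: "nat \<Rightarrow> nat \<Rightarrow> 'a \<Rightarrow> nat"
    and G :: "real \<Rightarrow> real"
  assumes "l > 0"
    and "\<And>j. real (k j) / real (n j) = l"
    and "filterlim n at_top sequentially"
    and "\<And>j. multinomial_vector (M j) (Y j) (n j) (k j) (\<lambda>i. 1 / real (n j))"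
    and "tail_extension (poisson_cdf l) G"
  shows "((\<lambda>j. measure (M j) {\<omega> \<in> space (M j). int (max_count (Y j) (n j) \<omega>) = m_seq G (n j)})
             \<sim>[sequentially] (\<lambda>j. p_seq G (n j))) \<and>
         ((\<lambda>j. measure (M j) {\<omega> \<in> space (M j). int (max_count (Y j) (n j) \<omega>) = m_seq G (n j) + 1})
             \<sim>[sequentially] (\<lambda>j. 1 - p_seq G (n j)))"
proof -
  let ?m = "\<lambda>j. nat (m_seq G (n j))" and ?\<theta> = "\<lambda>j. theta_seq G (n j)"
  let ?q = "\<lambda>j. cells_le_prob (n j) (k j)"
  note l = assms(1) and n = assms(3) and ext = assms(5)
  note comp = eventually_compose_filterlim[OF _ n]
  have k: "\<forall>\<^sub>F j in sequentially. real (k j) = l * real (n j)"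
  proof (intro always_eventually allI)
    fix j
    \<comment> \<open>If \<open>n j = 0\<close>, the quotient would be 0 by convention,
      contradicting \<open>l > 0\<close>.\<close>
    show "real (k j) = l * real (n j)"
      using assms(2)[of j] l by (cases "n j = 0") (auto simp: field_simps)
  qed
  note theta = comp[OF eventually_theta_seq_bounds[OF l ext]]
  note limits = filterlim_compose[OF filterlim_m_seq[OF l ext] n]
    comp[OF eventually_m_seq_le_ln[OF l ext]]
    theta[THEN eventually_mono, OF conjunct1]
    theta[THEN eventually_mono, OF conjunct1[OF conjunct2]]
    theta[THEN eventually_mono, OF conjunct2[OF conjunct2]]
  have pos: "\<forall>\<^sub>F j in sequentially. 1 \<le> m_seq G (n j)"
    using comp[OF eventually_m_seq_eq[OF l ext]] by eventually_elim simp
  \<comment> \<open>The natural subtraction \<open>nat i - 1\<close> is exact for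
    \<open>1 \<le> i\<close>, which \<open>pos\<close> supplies eventually.\<close>
  have eq: "measure (M j) {\<omega> \<in> space (M j). int (max_count (Y j) (n j) \<omega>) = i}
      = ?q j (nat i) - ?q j (nat i - 1)" if "1 \<le> i" for i j
  proof -
    have "nat i = Suc (nat i - 1)" using that by simp
    moreover have "int x = i \<longleftrightarrow> x = nat i" for x using that by auto
    ultimately show ?thesis
      using measure_max_count_eq_Suc[OF assms(4)[of j], of "nat i - 1"] by simp
  qed
  have "\<forall>\<^sub>F j in sequentially. (?q j (?m j) - ?q j (?m j - 1)) / exp (- ?\<theta> j)
      = measure (M j) {\<omega> \<in> space (M j). int (max_count (Y j) (n j) \<omega>) = m_seq G (n j)} / p_seq G (n j)"
    using pos by eventually_elim (simp add: eq p_seq_def)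
  from Lim_transform_eventually[OF max_eq_m_asymp[OF l n k limits] this]
  have 1: "(\<lambda>j. measure (M j) {\<omega> \<in> space (M j). int (max_count (Y j) (n j) \<omega>) = m_seq G (n j)}
      / p_seq G (n j)) \<longlonglongrightarrow> 1" .
  have "\<forall>\<^sub>F j in sequentially. (?q j (Suc (?m j)) - ?q j (?m j)) / (1 - exp (- ?\<theta> j))
      = measure (M j) {\<omega> \<in> space (M j). int (max_count (Y j) (n j) \<omega>) = m_seq G (n j) + 1}
        / (1 - p_seq G (n j))"
    using pos by eventually_elim (simp add: eq p_seq_def nat_add_distrib)
  from Lim_transform_eventually[OF max_eq_Suc_m_asymp[OF l n k limits] this]
  have 2: "(\<lambda>j. measure (M j) {\<omega> \<in> space (M j). int (max_count (Y j) (n j) \<omega>) = m_seq G (n j) + 1}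
      / (1 - p_seq G (n j))) \<longlonglongrightarrow> 1" .
  from 1 2 show ?thesis by (blast intro: asymp_equivI')
qed

end
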